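(* Every antipodal tight graph $\mathrm{AT}4(p,q,2)$ is pseudo-vertex-transitive.
   Context: For integers $p\ge 1$, $q\ge 2$, an $\mathrm{AT}4(p,q,2)$ is a non-bipartite distance-regular antipodal double cover of diameter $D=4$ with intersection array $\{q(pq+p+q),\,(q^2-1)(p+1),\,q(p+q)/2,\,1;\ 1,\,q(p+q)/2,\,(q^2-1)(p+1),\,q(pq+p+q)\}$; such a graph is tight and $Q$-polynomial. Let $\Gamma$ be one, with vertex set $X$, distance $\partial$, adjacency matrix $A$, $V=\mathbb{C}^X$. For $x\in X$ and $0\le i\le D$ let $E^*_i(x)$ be the diagonal matrix with $(E^*_i(x))_{yy}=1$ if $\partial(x,y)=i$ and $0$ otherwise. The Terwilliger algebra $T(x)$ is the subalgebra of $\mathrm{Mat}_X(\mathbb{C})$ generated by $A,E^*_0(x),\dots,E^*_D(x)$. The graph $\Gamma$ is pseudo-vertex-transitive if for all $x,y\in X$: (i) there is a $\mathbb{C}$-algebra isomorphism $T(x)\to T(y)$ sending $A\mapsto A$ and $E^*_i(x)\mapsto E^*_i(y)$ for all $i$; and (ii) there is a $\mathbb{C}$-linear bijection $\rho:V\to V$ with $\rho A=A\rho$ and $\rho E^*_i(x)=E^*_i(y)\rho$ for all $i$. *)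

theory Defs
  imports Complex_Main
begin

definition simple_graph :: "('a \<Rightarrow> 'a \<Rightarrow> bool) \<Rightarrow> bool" where
  "simple_graph E \<longleftrightarrow> (\<forall>u v. E u v \<longrightarrow> E v u) \<and> (\<forall>u. \<not> E u u)"

definition edge_rel :: "('a \<Rightarrow> 'a \<Rightarrow> bool) \<Rightarrow> ('a \<times> 'a) set" where
  "edge_rel E = {(u, v). E u v}"

definition connected_graph :: "('a \<Rightarrow> 'a \<Rightarrow> bool) \<Rightarrow> bool" where
  "connected_graph E \<longleftrightarrow> (\<forall>x y. \<exists>n. (x, y) \<in> edge_rel E ^^ n)"

definition gdist :: "('a \<Rightarrow> 'a \<Rightarrow> bool) \<Rightarrow> 'a \<Rightarrow> 'a \<Rightarrow> nat" where
  "gdist E x y = (LEAST n. (x, y) \<in> edge_rel E ^^ n)"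

definition has_diameter :: "('a \<Rightarrow> 'a \<Rightarrow> bool) \<Rightarrow> nat \<Rightarrow> bool" where
  "has_diameter E D \<longleftrightarrow> (\<forall>x y. gdist E x y \<le> D) \<and> (\<exists>x y. gdist E x y = D)"

text \<open>Distance-regular with intersection array
 {b_0,...,b_{D-1}; c_1,...,c_D}, given as lists bs = [b_0..b_{D-1}], cs = [c_1..c_D].\<close>
definition distance_regular_array ::
  "('a::finite \<Rightarrow> 'a \<Rightarrow> bool) \<Rightarrow> nat \<Rightarrow> real list \<Rightarrow> real list \<Rightarrow> bool" where
  "distance_regular_array E D bs cs \<longleftrightarrow>
     simple_graph E \<and> connected_graph E \<and> has_diameter E D \<and>
     length bs = D \<and> length cs = D \<and>
     (\<forall>x y. let i = gdist E x y in
        (i < D \<longrightarrow> real (card {z. E y z \<and> gdist E x z = i + 1}) = bs ! i) \<and>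
        (1 \<le> i \<longrightarrow> real (card {z. E y z \<and> gdist E x z = i - 1}) = cs ! (i - 1)))"

definition bipartite :: "('a \<Rightarrow> 'a \<Rightarrow> bool) \<Rightarrow> bool" where
  "bipartite E \<longleftrightarrow> (\<exists>f :: 'a \<Rightarrow> bool. \<forall>u v. E u v \<longrightarrow> f u \<noteq> f v)"

definition antipodal_rel :: "('a \<Rightarrow> 'a \<Rightarrow> bool) \<Rightarrow> nat \<Rightarrow> ('a \<times> 'a) set" where
  "antipodal_rel E D = {(x, y). x = y \<or> gdist E x y = D}"

definition antipodal_double_cover :: "('a::finite \<Rightarrow> 'a \<Rightarrow> bool) \<Rightarrow> nat \<Rightarrow> bool" where
  "antipodal_double_cover E D \<longleftrightarrow>
     equiv UNIV (antipodal_rel E D) \<and>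
     (\<forall>x. card (antipodal_rel E D `` {x}) = 2)"

definition AT4 :: "('a::finite \<Rightarrow> 'a \<Rightarrow> bool) \<Rightarrow> nat \<Rightarrow> nat \<Rightarrow> bool" where
  "AT4 E p q \<longleftrightarrow> 1 \<le> p \<and> 2 \<le> q \<and> \<not> bipartite E \<and> antipodal_double_cover E 4 \<and>
     distance_regular_array E 4
       [real q * (real p * real q + real p + real q), (real q ^ 2 - 1) * (real p + 1),
        real q * (real p + real q) / 2, 1]
       [1, real q * (real p + real q) / 2, (real q ^ 2 - 1) * (real p + 1),
        real q * (real p * real q + real p + real q)]"

type_synonym 'a cmat = "'a \<Rightarrow> 'a \<Rightarrow> complex"
type_synonym 'a cvec = "'a \<Rightarrow> complex"

definition madd :: "'a cmat \<Rightarrow> 'a cmat \<Rightarrow> 'a cmat" where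
  "madd M N = (\<lambda>u v. M u v + N u v)"

definition msmult :: "complex \<Rightarrow> 'a cmat \<Rightarrow> 'a cmat" where
  "msmult c M = (\<lambda>u v. c * M u v)"

definition mmult :: "'a::finite cmat \<Rightarrow> 'a cmat \<Rightarrow> 'a cmat" where
  "mmult M N = (\<lambda>u w. \<Sum>v\<in>UNIV. M u v * N v w)"

definition mvec :: "'a::finite cmat \<Rightarrow> 'a cvec \<Rightarrow> 'a cvec" where
  "mvec M f = (\<lambda>u. \<Sum>v\<in>UNIV. M u v * f v)"

definition adj_matrix :: "('a \<Rightarrow> 'a \<Rightarrow> bool) \<Rightarrow> 'a cmat" where
  "adj_matrix E = (\<lambda>u v. if E u v then 1 else 0)"

definition dual_idem :: "('a \<Rightarrow> 'a \<Rightarrow> bool) \<Rightarrow> 'a \<Rightarrow> nat \<Rightarrow> 'a cmat" where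
  "dual_idem E x i = (\<lambda>u v. if u = v \<and> gdist E x u = i then 1 else 0)"

inductive_set terwilliger :: "('a::finite \<Rightarrow> 'a \<Rightarrow> bool) \<Rightarrow> nat \<Rightarrow> 'a \<Rightarrow> 'a cmat set"
  for E D x where
  gen_adj: "adj_matrix E \<in> terwilliger E D x"
| gen_dual: "i \<le> D \<Longrightarrow> dual_idem E x i \<in> terwilliger E D x"
| add: "M \<in> terwilliger E D x \<Longrightarrow> N \<in> terwilliger E D x \<Longrightarrow> madd M N \<in> terwilliger E D x"
| smult: "M \<in> terwilliger E D x \<Longrightarrow> msmult c M \<in> terwilliger E D x"
| mult: "M \<in> terwilliger E D x \<Longrightarrow> N \<in> terwilliger E D x \<Longrightarrow> mmult M N \<in> terwilliger E D x"

definition pseudo_vertex_transitive :: "('a::finite \<Rightarrow> 'a \<Rightarrow> bool) \<Rightarrow> nat \<Rightarrow> bool" where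
  "pseudo_vertex_transitive E D \<longleftrightarrow>
    (\<forall>x y.
      (\<exists>\<phi> :: 'a cmat \<Rightarrow> 'a cmat.
         bij_betw \<phi> (terwilliger E D x) (terwilliger E D y) \<and>
         (\<forall>M\<in>terwilliger E D x. \<forall>N\<in>terwilliger E D x. \<phi> (madd M N) = madd (\<phi> M) (\<phi> N)) \<and>
         (\<forall>M\<in>terwilliger E D x. \<forall>c. \<phi> (msmult c M) = msmult c (\<phi> M)) \<and>
         (\<forall>M\<in>terwilliger E D x. \<forall>N\<in>terwilliger E D x. \<phi> (mmult M N) = mmult (\<phi> M) (\<phi> N)) \<and>
         \<phi> (adj_matrix E) = adj_matrix E \<and>
         (\<forall>i\<le>D. \<phi> (dual_idem E x i) = dual_idem E y i)) \<and>
      (\<exists>\<rho> :: 'a cvec \<Rightarrow> 'a cvec.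
         bij \<rho> \<and>
         (\<forall>f g. \<rho> (\<lambda>u. f u + g u) = (\<lambda>u. \<rho> f u + \<rho> g u)) \<and>
         (\<forall>c f. \<rho> (\<lambda>u. c * f u) = (\<lambda>u. c * \<rho> f u)) \<and>
         (\<forall>f. \<rho> (mvec (adj_matrix E) f) = mvec (adj_matrix E) (\<rho> f)) \<and>
         (\<forall>i\<le>D. \<forall>f. \<rho> (mvec (dual_idem E x i) f) = mvec (dual_idem E y i) (\<rho> f))))"

end

theory Submission
  imports Defs "HOL-Analysis.Analysis"
begin

text \<open>Let \<open>\<Pi>\<close> be the permutation matrix of the antipodal map, so that
  \<open>A\<^sup>2 = k + a\<^sub>1 A + c\<^sub>2 (J - (1 + A)(1 + \<Pi>))\<close>. Fix a base vertex and split \<open>A\<close> into blocks along its distance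
  partition. The \<open>\<Pi>\<close>-symmetric and \<open>\<Pi>\<close>-skew halves of this equation bound the local eigenvalues on the complement
  of the all-ones vector by \<open>p\<close> and \<open>-q\<close>, and a trace computation shows that no other eigenvalue occurs.
  At \<open>p\<close> one of the two bounds is attained and at \<open>-q\<close> the other one is, so each local eigenvector
  generates a three-dimensional module, with one dimension at each of the distances 1, 2 and 3. The rest of the second
  subconstituent splits into one-dimensional modules, since \<open>A\<close> satisfies a quadratic equation on each
  of its two halves. Together with the primary module this decomposes the standard module, and the structure
  constants and multiplicities depend on \<open>p\<close>, \<open>q\<close> and the number of vertices only. Matching the
  modules for two base vertices yields an orthogonal matrix \<open>\<rho>\<close> that intertwines all generators, and
  conjugation by \<open>\<rho>\<close> is the required isomorphism of Terwilliger algebras.\<close>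

section \<open>Square real matrices\<close>

text \<open>A separate type makes matrices an instance of \<open>real_algebra_1\<close>, so that
  ring rewriting applies to their products. Generators and projections are all real; complex
  matrices return only through \<open>cmat\<close>.\<close>

typedef 'a sqmat = "UNIV :: ('a \<Rightarrow> 'a \<Rightarrow> real) set"
  morphisms entry Mat ..

setup_lifting type_definition_sqmat

lemma sqmat_eqI: "(\<And>u v. entry M u v = entry N u v) \<Longrightarrow> M = N"
  by (simp add: entry_inject[symmetric] fun_eq_iff)

instantiation sqmat :: (finite) real_algebra_1
begin

lift_definition zero_sqmat :: "'a sqmat" is "\<lambda>u v. 0" .
lift_definition one_sqmat :: "'a sqmat" is "\<lambda>u v. if u = v then 1 else 0" .
lift_definition plus_sqmat :: "'a sqmat \<Rightarrow> 'a sqmat \<Rightarrow> 'a sqmat" is "\<lambda>M N u v. M u v + N u v" .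
lift_definition minus_sqmat :: "'a sqmat \<Rightarrow> 'a sqmat \<Rightarrow> 'a sqmat" is "\<lambda>M N u v. M u v - N u v" .
lift_definition uminus_sqmat :: "'a sqmat \<Rightarrow> 'a sqmat" is "\<lambda>M u v. - M u v" .
lift_definition times_sqmat :: "'a sqmat \<Rightarrow> 'a sqmat \<Rightarrow> 'a sqmat"
  is "\<lambda>M N u w. \<Sum>v\<in>UNIV. M u v * N v w" .
lift_definition scaleR_sqmat :: "real \<Rightarrow> 'a sqmat \<Rightarrow> 'a sqmat" is "\<lambda>c M u v. c * M u v" .

instance
proof
  fix a b c :: "'a sqmat" and r s :: real
  show "a * b * c = a * (b * c)"
  proof (transfer, intro ext)
    fix a b c :: "'a \<Rightarrow> 'a \<Rightarrow> real" and u w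
    have "(\<Sum>v\<in>UNIV. (\<Sum>t\<in>UNIV. a u t * b t v) * c v w)
        = (\<Sum>v\<in>UNIV. \<Sum>t\<in>UNIV. a u t * b t v * c v w)"
      by (simp add: sum_distrib_right)
    also have "\<dots> = (\<Sum>t\<in>UNIV. \<Sum>v\<in>UNIV. a u t * b t v * c v w)" by (rule sum.swap)
    finally show "(\<Sum>v\<in>UNIV. (\<Sum>t\<in>UNIV. a u t * b t v) * c v w)
        = (\<Sum>t\<in>UNIV. a u t * (\<Sum>v\<in>UNIV. b t v * c v w))"
      by (simp add: sum_distrib_left mult.assoc)
  qed
  show "a + b + c = a + (b + c)" by transfer (simp add: algebra_simps)
  show "a + b = b + a" by transfer (simp add: algebra_simps)
  show "0 + a = a" by transfer simp
  show "- a + a = 0" by transfer simp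
  show "a - b = a + - b" by transfer simp
  show "r *\<^sub>R (a + b) = r *\<^sub>R a + r *\<^sub>R b" by transfer (simp add: algebra_simps)
  show "(r + s) *\<^sub>R a = r *\<^sub>R a + s *\<^sub>R a" by transfer (simp add: algebra_simps)
  show "r *\<^sub>R s *\<^sub>R a = (r * s) *\<^sub>R a" by transfer (simp add: algebra_simps)
  show "1 *\<^sub>R a = a" by transfer simp
  show "(a + b) * c = a * c + b * c" by transfer (simp add: algebra_simps sum.distrib)
  show "a * (b + c) = a * b + a * c" by transfer (simp add: algebra_simps sum.distrib)
  show "r *\<^sub>R a * b = r *\<^sub>R (a * b)" by transfer (simp add: sum_distrib_left mult.assoc)
  show "a * r *\<^sub>R b = r *\<^sub>R (a * b)" by transfer (simp add: sum_distrib_left mult_ac)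
  show "1 * a = a" by transfer (simp add: if_distrib[of "\<lambda>x. x * _"] sum.delta cong: if_cong)
  show "a * 1 = a" by transfer (simp add: if_distrib[of "\<lambda>x. _ * x"] sum.delta cong: if_cong)
  show "(0::'a sqmat) \<noteq> 1" by transfer (auto simp: fun_eq_iff)
qed

end

lift_definition tp :: "'a sqmat \<Rightarrow> 'a sqmat" is "\<lambda>M u v. M v u" .
lift_definition tr :: "'a::finite sqmat \<Rightarrow> real" is "\<lambda>M. \<Sum>u\<in>UNIV. M u u" .

lemma entry_simps [simp]:
  "entry 0 u v = 0" "entry 1 u v = (if u = v then 1 else 0)"
  "entry (M + N) u v = entry M u v + entry N u v"
  "entry (M - N) u v = entry M u v - entry N u v"
  "entry (- M) u v = - entry M u v"
  "entry (c *\<^sub>R M) u v = c * entry M u v"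
  "entry (tp M) u v = entry M v u"
  "entry (Mat g) u v = g u v"
  by (transfer, simp)+

lemma entry_mult: "entry (M * N) u w = (\<Sum>v\<in>UNIV. entry M u v * entry N v w)"
  by transfer simp

lemma entry_sum: "entry (\<Sum>i\<in>I. M i) u v = (\<Sum>i\<in>I. entry (M i) u v)"
  by (induction I rule: infinite_finite_induct) auto

lemma tr_eq: "tr M = (\<Sum>u\<in>UNIV. entry M u u)"
  by transfer simp

lemma tp_simps [simp]:
  "tp (tp M) = M" "tp (M + N) = tp M + tp N" "tp (M - N) = tp M - tp N" "tp (- M) = - tp M"
  "tp (c *\<^sub>R M) = c *\<^sub>R tp M" "tp 0 = 0" "tp 1 = 1"
  by (rule sqmat_eqI; simp)+

lemma tp_mult [simp]: "tp (M * N) = tp N * tp M"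
  by (rule sqmat_eqI) (simp add: entry_mult mult.commute)

lemma tp_sum [simp]: "tp (\<Sum>i\<in>I. M i) = (\<Sum>i\<in>I. tp (M i))"
  by (induction I rule: infinite_finite_induct) auto

lemma tr_simps [simp]:
  "tr (M + N) = tr M + tr N" "tr (M - N) = tr M - tr N" "tr (- M) = - tr M"
  "tr (c *\<^sub>R M) = c * tr M" "tr 0 = 0"
  by (auto simp: tr_eq sum.distrib sum_subtractf sum_negf sum_distrib_left)

lemma tr_commute: "tr (M * N) = tr (N * M)"
  unfolding tr_eq entry_mult by (subst sum.swap) (simp add: mult.commute)

text \<open>This is the squared Frobenius norm. Matrix identities below are often proved by showing
  that the norm or the Gram matrix of a difference is zero, and inequalities come from its
  nonnegativity.\<close>

lemma tr_tp_mult: "tr (tp M * M) = (\<Sum>u\<in>UNIV. \<Sum>v\<in>UNIV. (entry M v u)\<^sup>2)"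
  by (simp add: tr_eq entry_mult power2_eq_square)

lemma tr_tp_mult_nonneg: "0 \<le> tr (tp M * M)"
  unfolding tr_tp_mult by (intro sum_nonneg) auto

lemma tr_tp_mult_eq_0: "tr (tp M * M) = 0 \<Longrightarrow> M = 0"
  unfolding tr_tp_mult by (rule sqmat_eqI) (simp add: sum_nonneg_eq_0_iff sum_nonneg)

lemma tp_mult_eq_0: "tp M * M = 0 \<Longrightarrow> M = 0"
  by (rule tr_tp_mult_eq_0) simp

section \<open>Orthogonal projections and partial isometries\<close>

definition sym_idem :: "'a::finite sqmat \<Rightarrow> bool" where
  "sym_idem P \<longleftrightarrow> tp P = P \<and> P * P = P"

text \<open>A symmetric idempotent is the orthogonal projection onto its range. An orthonormal basis
  of the range writes it as a sum of rank-one projections of trace one.\<close>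

lemma sym_idem_basis:
  fixes P :: "'a::finite sqmat"
  assumes "sym_idem P"
  obtains S :: "(real ^ 'a) set" where "finite S" "\<And>b c. b \<in> S \<Longrightarrow> c \<in> S \<Longrightarrow> b \<bullet> c = (if b = c then 1 else 0)"
    "P = (\<Sum>b\<in>S. Mat (\<lambda>u v. b $ u * b $ v))" "tr P = real (card S)"
proof -
  define M :: "real^'a^'a" where "M = (\<chi> u v. entry P u v)"
  have sym: "transpose M = M"
    using assms unfolding sym_idem_def M_def transpose_def
    by (metis (no_types, lifting) entry_simps(7) vec_lambda_beta vec_lambda_unique)
  have idem: "M ** M = M"
  proof -
    have "entry (P * P) u v = entry P u v" for u v using assms by (simp add: sym_idem_def)
    then show ?thesis by (simp add: M_def matrix_matrix_mult_def entry_mult)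
  qed
  let ?U = "range (\<lambda>v. M *v v)"
  have subU: "subspace ?U"
    by (rule linear_subspace_image) (auto intro: matrix_vector_mul_linear subspace_UNIV)
  obtain S where S: "S \<subseteq> ?U" "pairwise orthogonal S" "\<And>x. x \<in> S \<Longrightarrow> norm x = 1"
    "independent S" "span S = ?U"
    using orthonormal_basis_subspace[OF subU] by metis
  have fin: "finite S" using S(4) by (rule independent_imp_finite)
  have inner: "b \<bullet> c = (if b = c then 1 else 0)" if "b \<in> S" "c \<in> S" for b c
  proof (cases "b = c")
    case True
    then show ?thesis using S(3)[OF that(1)] by (simp add: norm_eq_1)
  next
    case False
    then show ?thesis using S(2) that unfolding pairwise_def orthogonal_def by auto
  qed
  have fixS: "M *v b = b" if "b \<in> S" for b
    using that S(1) idem by (auto simp: matrix_vector_mul_assoc)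
  have exp: "M *v v = (\<Sum>b\<in>S. (b \<bullet> v) *\<^sub>R b)" for v
  proof -
    have "M *v v \<in> span S" using S(5) by auto
    then obtain c where c: "M *v v = (\<Sum>b\<in>S. c b *\<^sub>R b)"
      using fin by (auto simp: span_finite)
    have "c b = b \<bullet> v" if "b \<in> S" for b
    proof -
      have "b \<bullet> (M *v v) = (\<Sum>d\<in>S. c d * (b \<bullet> d))" by (simp add: c inner_sum_right)
      also have "\<dots> = (\<Sum>d\<in>S. if b = d then c d else 0)"
        using that inner by (intro sum.cong) auto
      also have "\<dots> = c b" using that fin by simp
      finally have "c b = b \<bullet> (M *v v)" by simp
      also have "\<dots> = (M *v b) \<bullet> v"
        by (metis dot_lmul_matrix sym transpose_matrix_vector)
      finally show ?thesis using fixS[OF that] by simp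
    qed
    then show ?thesis using c by (simp cong: sum.cong)
  qed
  have P: "P = (\<Sum>b\<in>S. Mat (\<lambda>u v. b $ u * b $ v))"
  proof (rule sqmat_eqI)
    fix u v
    have "entry P u v = (M *v axis v 1) $ u" by (simp add: M_def matrix_vector_mult_basis column_def)
    also have "\<dots> = (\<Sum>b\<in>S. b $ u * b $ v)" by (simp add: exp inner_axis mult.commute)
    finally show "entry P u v = entry (\<Sum>b\<in>S. Mat (\<lambda>u v. b $ u * b $ v)) u v" by (simp add: entry_sum)
  qed
  have "tr P = (\<Sum>u\<in>UNIV. \<Sum>b\<in>S. b $ u * b $ u)" unfolding tr_eq by (subst P) (simp add: entry_sum)
  also have "\<dots> = (\<Sum>b\<in>S. b \<bullet> b)" by (subst sum.swap) (simp add: inner_vec_def)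
  also have "\<dots> = (\<Sum>b\<in>S. 1)" using inner by (intro sum.cong) auto
  finally show thesis using that[OF fin inner P] by simp
qed

text \<open>\<open>R\<close> is a partial isometry matching orthonormal bases of the two ranges;
  these have the same size because the trace of a projection is its rank.\<close>

lemma sym_idem_equivalent:
  fixes P Q :: "'a::finite sqmat"
  assumes "sym_idem P" "sym_idem Q" "tr P = tr Q"
  obtains R where "tp R * R = P" "R * tp R = Q"
proof -
  obtain S where S: "finite S" "\<And>b c. b \<in> S \<Longrightarrow> c \<in> S \<Longrightarrow> b \<bullet> c = (if b = c then 1 else 0)"
    "P = (\<Sum>b\<in>S. Mat (\<lambda>u v. b $ u * b $ v))" "tr P = real (card S)"
    by (rule sym_idem_basis[OF assms(1)]) (rule that)
  obtain S' where S': "finite S'" "\<And>b c. b \<in> S' \<Longrightarrow> c \<in> S' \<Longrightarrow> b \<bullet> c = (if b = c then 1 else 0)"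
    "Q = (\<Sum>b\<in>S'. Mat (\<lambda>u v. b $ u * b $ v))" "tr Q = real (card S')"
    by (rule sym_idem_basis[OF assms(2)]) (rule that)
  have "card S = card S'" using assms(3) S(4) S'(4) by simp
  then obtain h where h: "bij_betw h S S'" using S(1) S'(1) finite_same_card_bij by blast
  define R where "R = (\<Sum>b\<in>S. Mat (\<lambda>u v. h b $ u * b $ v))"
  have outer: "Mat (\<lambda>u v. a $ u * b $ v) * Mat (\<lambda>u v. c $ u * d $ v)
      = (b \<bullet> c) *\<^sub>R Mat (\<lambda>u v. a $ u * d $ v)" for a b c d :: "real ^ 'a"
    by (rule sqmat_eqI) (simp add: entry_mult inner_vec_def sum_distrib_left sum_distrib_right mult_ac)
  have outer_tp: "tp (Mat (\<lambda>u v. a $ u * b $ v)) = Mat (\<lambda>u v. b $ u * a $ v)" for a b :: "real ^ 'a"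
    by (rule sqmat_eqI) simp
  have hinner: "h b \<bullet> h c = (if b = c then 1 else 0)" if "b \<in> S" "c \<in> S" for b c
    using that h S'(2) by (metis bij_betwE bij_betw_inv_into_left)
  have "tp R * R = (\<Sum>b\<in>S. \<Sum>c\<in>S. (h b \<bullet> h c) *\<^sub>R Mat (\<lambda>u v. b $ u * c $ v))"
    by (simp add: R_def sum_distrib_left sum_distrib_right outer outer_tp) (rule sum.swap)
  also have "\<dots> = (\<Sum>b\<in>S. \<Sum>c\<in>S. if b = c then Mat (\<lambda>u v. b $ u * c $ v) else 0)"
    by (intro sum.cong refl) (simp add: hinner)
  also have "\<dots> = P" using S(1) by (simp add: S(3))
  finally have 1: "tp R * R = P" .
  have "R * tp R = (\<Sum>b\<in>S. \<Sum>c\<in>S. (b \<bullet> c) *\<^sub>R Mat (\<lambda>u v. h b $ u * h c $ v))"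
    by (simp add: R_def sum_distrib_left sum_distrib_right outer outer_tp) (rule sum.swap)
  also have "\<dots> = (\<Sum>b\<in>S. \<Sum>c\<in>S. if b = c then Mat (\<lambda>u v. h b $ u * h c $ v) else 0)"
    by (intro sum.cong refl) (simp add: S(2))
  also have "\<dots> = (\<Sum>b\<in>S. Mat (\<lambda>u v. h b $ u * h b $ v))" using S(1) by simp
  also have "\<dots> = Q" unfolding S'(3) by (rule sum.reindex_bij_betw[OF h])
  finally show thesis using that 1 by blast
qed

section \<open>Intertwiners and thin modules\<close>

text \<open>Lets an equation for a product of two factors rewrite inside longer products associated
  to the right.\<close>

lemma mult_ext: "a * b = c \<Longrightarrow> a * (b * x) = c * (x :: 'b::semigroup_mult)"
  by (metis mult.assoc)

text \<open>The Gram matrix of \<open>M * P - M\<close> expands to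
  \<open>P - P - P + P\<close>.\<close>

lemma sym_idem_mult_id: "sym_idem P \<Longrightarrow> tp M * M = P \<Longrightarrow> M * P = M"
proof -
  assume P: "sym_idem P" "tp M * M = P"
  have "tp (M * P - M) * (M * P - M) = P * (tp M * M) * P - P * (tp M * M) - (tp M * M) * P + tp M * M"
    using P(1) by (simp add: sym_idem_def algebra_simps)
  also have "\<dots> = 0" using P by (simp add: sym_idem_def)
  finally show "M * P = M" using tp_mult_eq_0 by fastforce
qed

text \<open>Here \<open>\<rho>\<close> is a partial isometry with initial projection
  \<open>Z\<close> and final projection \<open>Z'\<close>. Such pieces add up along a decomposition
  of the identity, see \<open>intertwined_partition\<close>.\<close>

definition intertwined ::
    "('o \<Rightarrow> 'a::finite sqmat) \<Rightarrow> ('o \<Rightarrow> 'a sqmat) \<Rightarrow> 'a sqmat \<Rightarrow> 'a sqmat \<Rightarrow> bool" where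
  "intertwined X X' Z Z' \<longleftrightarrow> sym_idem Z \<and> sym_idem Z' \<and>
     (\<exists>\<rho>. (\<forall>k. X' k * \<rho> = \<rho> * X k) \<and> tp \<rho> * \<rho> = Z \<and> \<rho> * tp \<rho> = Z')"

text \<open>The \<open>L i\<close> embed the range of \<open>P\<close> (up to the factor \<open>w i\<close>) isometrically onto pairwise orthogonal subspaces,
  whose sum is a module of multiplicity \<open>tr P\<close> with structure constants \<open>m k\<close> for \<open>X k\<close>.\<close>

definition thin_module ::
    "('o \<Rightarrow> 'a::finite sqmat) \<Rightarrow> 'a sqmat \<Rightarrow> 'j set \<Rightarrow> ('j \<Rightarrow> 'a sqmat) \<Rightarrow> ('j \<Rightarrow> real) \<Rightarrow>
     ('o \<Rightarrow> 'j \<Rightarrow> 'j \<Rightarrow> real) \<Rightarrow> bool" where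
  "thin_module X P I L w m \<longleftrightarrow> sym_idem P \<and> finite I \<and> (\<forall>i\<in>I. w i \<noteq> 0 \<and> L i * P = L i) \<and>
     (\<forall>i\<in>I. \<forall>j\<in>I. tp (L i) * L j = (if i = j then w i *\<^sub>R P else 0)) \<and>
     (\<forall>k. \<forall>j\<in>I. X k * L j = (\<Sum>i\<in>I. m k i j *\<^sub>R L i))"

text \<open>Since \<open>tp (L i) * L i = w i *\<^sub>R P\<close>, each summand is the orthogonal
  projection onto the range of \<open>L i\<close>.\<close>

definition module_proj :: "'j set \<Rightarrow> ('j \<Rightarrow> 'a::finite sqmat) \<Rightarrow> ('j \<Rightarrow> real) \<Rightarrow> 'a sqmat" where
  "module_proj I L w = (\<Sum>i\<in>I. (1 / w i) *\<^sub>R (L i * tp (L i)))"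

text \<open>\<open>\<rho>\<close> carries the copy \<open>L i\<close> of the range of
  \<open>P\<close> to the copy \<open>L' i\<close> of the range of \<open>P'\<close> along
  \<open>R\<close>. Orthogonality of the copies leaves the diagonal terms only. With equal modules
  and \<open>R = P\<close> the same computation shows that \<open>module_proj\<close> is
  idempotent.\<close>

lemma thin_module_dual_basis:
  assumes "thin_module X P I L w m" "thin_module X' P' I L' w m'" "tp R * R = P" "R * tp R = P'"
  defines "\<rho> \<equiv> \<Sum>i\<in>I. (1 / w i) *\<^sub>R (L' i * R * tp (L i))"
  shows "tp \<rho> * \<rho> = module_proj I L w"
proof -
  have P: "sym_idem P" "finite I" "sym_idem P'" using assms by (auto simp: thin_module_def)
  have "tp R * P' = tp R"
    using sym_idem_mult_id[OF P(3), of "tp R"] assms(4) by simp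
  then have RPR: "tp R * (P' * R) = P" using assms(3) by (simp add: mult.assoc[symmetric])
  have summand: "((1 / w i) *\<^sub>R (L i * tp R * tp (L' i))) * ((1 / w j) *\<^sub>R (L' j * R * tp (L j)))
     = (if i = j then (1 / w j) *\<^sub>R (L j * tp (L j)) else 0)" if "i \<in> I" "j \<in> I" for i j
  proof -
    have "tp (L' i) * L' j = (if i = j then w i *\<^sub>R P' else 0)"
      and w: "w i \<noteq> 0" and LP: "L j * P = L j"
      using assms(1,2) that by (auto simp: thin_module_def)
    then have gram: "tp (L' i) * (L' j * Y) = (if i = j then w i *\<^sub>R (P' * Y) else 0)" for Y
      by (simp add: mult_ext)
    have RPR': "tp R * (P' * (R * Y)) = P * Y" for Y
      by (simp add: RPR[symmetric] mult.assoc)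
    show ?thesis
      using w by (auto simp: mult.assoc gram RPR' mult_ext[OF LP])
  qed
  have "tp \<rho> * \<rho> = (\<Sum>i\<in>I. \<Sum>j\<in>I.
      ((1 / w i) *\<^sub>R (L i * tp R * tp (L' i))) * ((1 / w j) *\<^sub>R (L' j * R * tp (L j))))"
    by (simp add: \<rho>_def sum_product mult.assoc)
  also have "\<dots> = (\<Sum>i\<in>I. \<Sum>j\<in>I. if i = j then (1 / w j) *\<^sub>R (L j * tp (L j)) else 0)"
    by (intro sum.cong refl summand)
  also have "\<dots> = module_proj I L w" using P(2) by (simp add: module_proj_def)
  finally show ?thesis .
qed

lemma thin_module_proj_idem:
  assumes "thin_module X P I L w m"
  shows "sym_idem (module_proj I L w)"
proof -
  have P: "sym_idem P" "finite I" using assms by (auto simp: thin_module_def)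
  have PP: "tp P * P = P" "P * tp P = P" using P by (auto simp: sym_idem_def)
  define Z where "Z = (\<Sum>i\<in>I. (1 / w i) *\<^sub>R (L i * P * tp (L i)))"
  have Z: "Z = module_proj I L w"
    using assms unfolding Z_def module_proj_def thin_module_def by (intro sum.cong) auto
  have "tp Z * Z = Z" unfolding Z_def
    using thin_module_dual_basis[OF assms assms PP] unfolding Z[symmetric] Z_def .
  moreover have "tp Z = Z" unfolding Z module_proj_def by simp
  ultimately show ?thesis unfolding Z sym_idem_def by simp
qed

lemma thin_module_intertwined:
  assumes M: "thin_module X P I L w m" and M': "thin_module X' P' I L' w m"
    and tr: "tr P = tr P'" and sym: "\<And>k. tp (X k) = X k"
  shows "intertwined X X' (module_proj I L w) (module_proj I L' w)"
proof -
  have P: "sym_idem P" "finite I" "sym_idem P'" using assms by (auto simp: thin_module_def)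
  obtain R where R: "tp R * R = P" "R * tp R = P'"
    using sym_idem_equivalent[OF P(1,3) tr] by blast
  have RP: "R * P = R" using sym_idem_mult_id[OF P(1)] R by simp
  define \<rho> where "\<rho> = (\<Sum>i\<in>I. (1 / w i) *\<^sub>R (L' i * R * tp (L i)))"
  have 1: "tp \<rho> * \<rho> = module_proj I L w"
    unfolding \<rho>_def by (rule thin_module_dual_basis[OF M M' R])
  have "tp (tp \<rho>) * tp \<rho> = module_proj I L' w"
    using thin_module_dual_basis[OF M' M, of "tp R"] R by (simp add: \<rho>_def mult.assoc)
  then have 2: "\<rho> * tp \<rho> = module_proj I L' w" by simp
  have 3: "X' k * \<rho> = \<rho> * X k" for k
  proof -
    \<comment> \<open>\<open>X' k\<close> acts on \<open>\<rho>\<close> from the left through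
      columns of \<open>m k\<close>, and \<open>X k\<close> from the right through rows. Symmetry of
      \<open>X k\<close> exchanges \<open>i\<close> and \<open>j\<close> in
      \<open>tp (L i) * (X k * L j)\<close> and so reconciles the two. The equation is stated for
      multiples of \<open>R\<close>, as \<open>P\<close> may be zero.\<close>
    have coeff: "(m k i j / w j) *\<^sub>R R = (m k j i / w i) *\<^sub>R R" if ij: "i \<in> I" "j \<in> I" for i j
    proof -
      have act: "X k * L j = (\<Sum>i\<in>I. m k i j *\<^sub>R L i)" if "j \<in> I" for j
        using M that by (auto simp: thin_module_def)
      have gram: "tp (L i) * (X k * L j) = (m k i j * w i) *\<^sub>R P" if "i \<in> I" "j \<in> I" for i j
      proof -
        have "tp (L i) * (X k * L j) = (\<Sum>l\<in>I. m k l j *\<^sub>R (tp (L i) * L l))"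
          using act that by (simp add: sum_distrib_left)
        also have "\<dots> = (\<Sum>l\<in>I. if i = l then (m k i j * w i) *\<^sub>R P else 0)"
          using M that by (intro sum.cong) (auto simp: thin_module_def)
        finally show ?thesis using that P(2) by simp
      qed
      have "(m k j i * w j) *\<^sub>R P = tp (tp (L i) * (X k * L j))"
        using gram[OF ij(2,1)] sym by (simp add: mult.assoc)
      then have "(m k i j * w i) *\<^sub>R P = (m k j i * w j) *\<^sub>R P"
        unfolding gram[OF ij] using P(1) by (auto simp: sym_idem_def)
      then have "R * ((m k i j * w i) *\<^sub>R P) = R * ((m k j i * w j) *\<^sub>R P)" by (rule arg_cong)
      then have "(m k i j * w i) *\<^sub>R R = (m k j i * w j) *\<^sub>R R"
        unfolding mult_scaleR_right RP .
      moreover have "w i \<noteq> 0" "w j \<noteq> 0" using M ij by (auto simp: thin_module_def)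
      ultimately show ?thesis by (auto simp: field_simps)
    qed
    have "X' k * \<rho> = (\<Sum>j\<in>I. (1 / w j) *\<^sub>R (X' k * L' j * R * tp (L j)))"
      by (simp add: \<rho>_def sum_distrib_left mult.assoc)
    also have "\<dots> = (\<Sum>j\<in>I. \<Sum>i\<in>I. L' i * ((m k i j / w j) *\<^sub>R R) * tp (L j))"
      using M' by (intro sum.cong refl)
        (simp add: thin_module_def sum_distrib_right scaleR_sum_right mult.assoc)
    also have "\<dots> = (\<Sum>j\<in>I. \<Sum>i\<in>I. L' i * ((m k j i / w i) *\<^sub>R R) * tp (L j))"
      by (intro sum.cong refl) (simp only: coeff)
    also have "\<dots> = (\<Sum>i\<in>I. \<Sum>j\<in>I. L' i * ((m k j i / w i) *\<^sub>R R) * tp (L j))"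
      by (rule sum.swap)
    also have "\<dots> = (\<Sum>i\<in>I. (1 / w i) *\<^sub>R (L' i * (R * tp (X k * L i))))"
      using M by (intro sum.cong refl)
        (simp add: thin_module_def sum_distrib_left scaleR_sum_right mult.assoc del: tp_mult)
    also have "\<dots> = \<rho> * X k"
      by (simp add: \<rho>_def sum_distrib_right mult.assoc sym)
    finally show ?thesis .
  qed
  show ?thesis unfolding intertwined_def
    using 1 2 3 thin_module_proj_idem[OF M] thin_module_proj_idem[OF M'] by blast
qed

text \<open>\<open>tr (Z c * Z d)\<close> is the squared norm of \<open>Z d * Z c\<close>. Summed
  over all \<open>d\<close> it gives \<open>tr (Z c)\<close>, which the term \<open>d = c\<close>
  already accounts for, so the other terms vanish.\<close>

lemma sym_idem_partition_orthogonal: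
  fixes Z :: "'c \<Rightarrow> 'a::finite sqmat"
  assumes "finite C" "\<And>c. c \<in> C \<Longrightarrow> sym_idem (Z c)" "(\<Sum>c\<in>C. Z c) = 1" "c \<in> C" "d \<in> C" "c \<noteq> d"
  shows "Z c * Z d = 0"
proof -
  have nonneg: "tr (Z c * Z d) = tr (tp (Z d * Z c) * (Z d * Z c))" if "c \<in> C" "d \<in> C" for c d
  proof -
    have "tr (tp (Z d * Z c) * (Z d * Z c)) = tr (Z c * (Z d * Z d * Z c))"
      using assms(2)[OF that(1)] assms(2)[OF that(2)]
      by (simp add: sym_idem_def mult.assoc mult_ext[of "Z d" "Z d" "Z d"])
    also have "\<dots> = tr (Z d * Z c * Z c)"
      using assms(2)[OF that(2)] by (subst tr_commute) (simp add: sym_idem_def mult.assoc)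
    also have "\<dots> = tr (Z d * Z c)" using assms(2)[OF that(1)] by (simp add: sym_idem_def mult.assoc)
    finally show ?thesis by (simp add: tr_commute)
  qed
  have "tr (Z c) = tr (Z c * (\<Sum>d\<in>C. Z d))" using assms(3) by simp
  also have "\<dots> = (\<Sum>d\<in>C. tr (Z c * Z d))" unfolding sum_distrib_left
    using assms(1) by (induction C rule: finite_induct) auto
  also have "\<dots> = tr (Z c * Z c) + (\<Sum>d\<in>C - {c}. tr (Z c * Z d))"
    using assms(1,4) by (simp add: sum.remove)
  finally have "(\<Sum>d\<in>C - {c}. tr (Z c * Z d)) = 0" using assms(2,4) by (simp add: sym_idem_def)
  moreover have "\<And>d. d \<in> C - {c} \<Longrightarrow> 0 \<le> tr (Z c * Z d)"
    using nonneg assms(4) tr_tp_mult_nonneg by (metis DiffD1)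
  ultimately have "\<forall>d \<in> C - {c}. tr (Z c * Z d) = 0"
    using assms(1) by (subst (asm) sum_nonneg_eq_0_iff) auto
  then have "tr (Z c * Z d) = 0" using assms by auto
  then have "Z d * Z c = 0" unfolding nonneg[OF assms(4,5)] by (rule tr_tp_mult_eq_0)
  then have "tp (Z d * Z c) = 0" by (simp del: tp_mult)
  then show ?thesis using assms by (simp add: sym_idem_def)
qed

text \<open>The sum of the partial isometries is an orthogonal matrix: their mixed products contain
  a factor \<open>Zs ! c * Zs ! d\<close> or \<open>Zs' ! c * Zs' ! d\<close> with distinct indices,
  and this is zero.\<close>

lemma intertwined_partition:
  assumes "list_all2 (intertwined X X') Zs Zs'" "sum_list Zs = 1" "sum_list Zs' = 1"
  shows "intertwined X X' 1 1"
proof -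
  define C where "C = {..<length Zs}"
  have len: "length Zs' = length Zs" and fin: "finite C"
    using assms(1) by (auto simp: list_all2_lengthD C_def)
  have sums: "(\<Sum>c\<in>C. Zs ! c) = 1" "(\<Sum>c\<in>C. Zs' ! c) = 1"
    using assms(2,3) len by (simp_all add: sum_list_sum_nth C_def atLeast0LessThan)
  have ex: "\<forall>c\<in>C. intertwined X X' (Zs ! c) (Zs' ! c)"
    using assms(1) by (auto simp: list_all2_conv_all_nth C_def)
  then have idem: "sym_idem (Zs ! c)" "sym_idem (Zs' ! c)" if "c \<in> C" for c
    using that by (auto simp: intertwined_def)
  from ex have "\<forall>c\<in>C. \<exists>\<rho>. (\<forall>k. X' k * \<rho> = \<rho> * X k) \<and> tp \<rho> * \<rho> = Zs ! c \<and> \<rho> * tp \<rho> = Zs' ! c"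
    by (simp add: intertwined_def)
  then obtain r where r: "\<And>c k. c \<in> C \<Longrightarrow> X' k * r c = r c * X k"
    "\<And>c. c \<in> C \<Longrightarrow> tp (r c) * r c = Zs ! c" "\<And>c. c \<in> C \<Longrightarrow> r c * tp (r c) = Zs' ! c"
    by (metis bchoice)
  have cross: "tp (r c) * r d = (if c = d then Zs ! d else 0)"
    "r c * tp (r d) = (if c = d then Zs' ! d else 0)" if cd: "c \<in> C" "d \<in> C" for c d
  proof -
    have a: "r c * Zs ! c = r c" "tp (r c) * Zs' ! c = tp (r c)" if "c \<in> C" for c
      using sym_idem_mult_id[OF idem(1)[OF that], of "r c"]
        sym_idem_mult_id[OF idem(2)[OF that], of "tp (r c)"] r that by auto
    have b: "Zs ! c * tp (r c) = tp (r c)" "Zs' ! c * r c = r c" if "c \<in> C" for c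
      using arg_cong[OF a(1)[OF that], of tp] arg_cong[OF a(2)[OF that], of tp] idem[OF that]
      by (auto simp: sym_idem_def)
    have "tp (r c) * r d = tp (r c) * (Zs' ! c * Zs' ! d) * r d"
      using a(2)[OF cd(1)] b(2)[OF cd(2)] by (metis mult.assoc)
    moreover have "r c * tp (r d) = r c * (Zs ! c * Zs ! d) * tp (r d)"
      using a(1)[OF cd(1)] b(1)[OF cd(2)] by (metis mult.assoc)
    ultimately show "tp (r c) * r d = (if c = d then Zs ! d else 0)"
      "r c * tp (r d) = (if c = d then Zs' ! d else 0)"
      using r cd sym_idem_partition_orthogonal[OF fin idem(1) sums(1) cd]
        sym_idem_partition_orthogonal[OF fin idem(2) sums(2) cd] by auto
  qed
  define \<rho> where "\<rho> = (\<Sum>c\<in>C. r c)"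
  have "X' k * \<rho> = \<rho> * X k" for k
    unfolding \<rho>_def sum_distrib_left sum_distrib_right by (intro sum.cong refl r)
  moreover have "tp \<rho> * \<rho> = 1"
  proof -
    have "tp \<rho> * \<rho> = (\<Sum>c\<in>C. \<Sum>d\<in>C. if c = d then Zs ! d else 0)"
      unfolding \<rho>_def tp_sum sum_product by (intro sum.cong refl cross)
    then show ?thesis using sums fin by simp
  qed
  moreover have "\<rho> * tp \<rho> = 1"
  proof -
    have "\<rho> * tp \<rho> = (\<Sum>c\<in>C. \<Sum>d\<in>C. if c = d then Zs' ! d else 0)"
      unfolding \<rho>_def tp_sum sum_product by (intro sum.cong refl cross)
    then show ?thesis using sums fin by simp
  qed
  ultimately show ?thesis unfolding intertwined_def sym_idem_def by auto
qed

text \<open>Lagrange interpolation: where \<open>C\<close> satisfies the quadratic equation with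
  roots \<alpha> and \<beta> on the range of \<open>F\<close>, this is the projection onto the
  \<alpha>-eigenspace. Its trace, the multiplicity, is determined by the traces of
  \<open>C * F\<close> and \<open>F\<close>.\<close>

definition eigen_part :: "'a::finite sqmat \<Rightarrow> 'a sqmat \<Rightarrow> real \<Rightarrow> real \<Rightarrow> 'a sqmat" where
  "eigen_part C F \<alpha> \<beta> = (1 / (\<alpha> - \<beta>)) *\<^sub>R (C * F - \<beta> *\<^sub>R F)"

lemma eigen_part:
  assumes "sym_idem F" "tp C = C" "C * F = F * C"
    and quad: "C * (C * F) = (\<alpha> + \<beta>) *\<^sub>R (C * F) - (\<alpha> * \<beta>) *\<^sub>R F" and "\<alpha> \<noteq> \<beta>"
  shows "sym_idem (eigen_part C F \<alpha> \<beta>)"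
    and "C * eigen_part C F \<alpha> \<beta> = \<alpha> *\<^sub>R eigen_part C F \<alpha> \<beta>"
    and "F * eigen_part C F \<alpha> \<beta> = eigen_part C F \<alpha> \<beta>"
    and "eigen_part C F \<alpha> \<beta> + eigen_part C F \<beta> \<alpha> = F"
    and "tr (eigen_part C F \<alpha> \<beta>) = (tr (C * F) - \<beta> * tr F) / (\<alpha> - \<beta>)"
proof -
  let ?S = "C * F - \<beta> *\<^sub>R F"
  have F: "F * F = F" "tp F = F" using assms(1) by (auto simp: sym_idem_def)
  have act: "C * ?S = \<alpha> *\<^sub>R ?S" using quad by (simp add: algebra_simps)
  have FS: "F * ?S = ?S"
  proof -
    have "F * (C * F) = C * F" using assms(3) F by (metis mult.assoc)
    then show ?thesis using F by (simp add: algebra_simps)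
  qed
  have "?S * ?S = C * (F * ?S) - \<beta> *\<^sub>R (F * ?S)" by (simp add: algebra_simps)
  also have "\<dots> = (\<alpha> - \<beta>) *\<^sub>R ?S" unfolding FS act by (simp add: scaleR_left_diff_distrib)
  finally have SS: "?S * ?S = (\<alpha> - \<beta>) *\<^sub>R ?S" .
  have "tp ?S = ?S" using assms(2,3) F by simp
  then show "sym_idem (eigen_part C F \<alpha> \<beta>)" using SS assms(5) by (simp add: sym_idem_def eigen_part_def)
  show "C * eigen_part C F \<alpha> \<beta> = \<alpha> *\<^sub>R eigen_part C F \<alpha> \<beta>"
    unfolding eigen_part_def mult_scaleR_right act by simp
  show "F * eigen_part C F \<alpha> \<beta> = eigen_part C F \<alpha> \<beta>"
    unfolding eigen_part_def mult_scaleR_right FS by simp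
  show "tr (eigen_part C F \<alpha> \<beta>) = (tr (C * F) - \<beta> * tr F) / (\<alpha> - \<beta>)" by (simp add: eigen_part_def)
  have "eigen_part C F \<beta> \<alpha> = (1 / (\<alpha> - \<beta>)) *\<^sub>R (\<alpha> *\<^sub>R F - C * F)"
    unfolding eigen_part_def
    by (metis (no_types, lifting) minus_diff_eq minus_divide_right scaleR_minus_left scaleR_minus_right)
  then have "eigen_part C F \<alpha> \<beta> + eigen_part C F \<beta> \<alpha> = (1 / (\<alpha> - \<beta>)) *\<^sub>R ((\<alpha> - \<beta>) *\<^sub>R F)"
    unfolding eigen_part_def by (simp only: scaleR_add_right[symmetric]) (simp add: algebra_simps)
  then show "eigen_part C F \<alpha> \<beta> + eigen_part C F \<beta> \<alpha> = F" using assms(5) by simp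
qed

section \<open>Passage to complex matrices and Terwilliger algebras\<close>

definition cmat :: "'a sqmat \<Rightarrow> 'a cmat" where
  "cmat M = (\<lambda>u v. complex_of_real (entry M u v))"

lemma mmult_assoc: "mmult (mmult M N) L = mmult M (mmult N L)"
proof (intro ext)
  fix u w
  have "(\<Sum>v\<in>UNIV. (\<Sum>t\<in>UNIV. M u t * N t v) * L v w)
      = (\<Sum>v\<in>UNIV. \<Sum>t\<in>UNIV. M u t * N t v * L v w)"
    by (simp add: sum_distrib_right)
  also have "\<dots> = (\<Sum>t\<in>UNIV. \<Sum>v\<in>UNIV. M u t * N t v * L v w)" by (rule sum.swap)
  finally show "mmult (mmult M N) L u w = mmult M (mmult N L) u w"
    by (simp add: mmult_def sum_distrib_left mult.assoc)
qed

lemma mvec_mvec: "mvec M (mvec N f) = mvec (mmult M N) f"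
proof (intro ext)
  fix u
  have "(\<Sum>v\<in>UNIV. \<Sum>t\<in>UNIV. M u v * N v t * f t) = (\<Sum>t\<in>UNIV. \<Sum>v\<in>UNIV. M u v * N v t * f t)"
    by (rule sum.swap)
  then show "mvec M (mvec N f) u = mvec (mmult M N) f u"
    by (simp add: mvec_def mmult_def sum_distrib_left sum_distrib_right mult.assoc)
qed

lemma mmult_linear:
  "mmult M (madd N L) = madd (mmult M N) (mmult M L)"
  "mmult (madd N L) M = madd (mmult N M) (mmult L M)"
  "mmult M (msmult c N) = msmult c (mmult M N)"
  "mmult (msmult c N) M = msmult c (mmult N M)"
  by (simp_all add: mmult_def madd_def msmult_def fun_eq_iff algebra_simps sum.distrib sum_distrib_left)

lemma cmat_mult: "mmult (cmat M) (cmat N) = cmat (M * N)"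
  by (simp add: cmat_def mmult_def entry_mult fun_eq_iff)

lemma mmult_cmat_1: "mmult (cmat 1) M = M" "mmult M (cmat 1) = M"
  by (simp_all add: cmat_def mmult_def fun_eq_iff if_distrib[of "\<lambda>x. x * _"] if_distrib[of "\<lambda>x. _ * x"]
      if_distrib[of complex_of_real] sum.delta cong: if_cong)

lemma mvec_cmat_1: "mvec (cmat 1) f = f"
  by (simp add: cmat_def mvec_def fun_eq_iff if_distrib[of "\<lambda>x. x * _"] 
      if_distrib[of complex_of_real] sum.delta cong: if_cong)

definition adj :: "('a \<Rightarrow> 'a \<Rightarrow> bool) \<Rightarrow> 'a sqmat" where
  "adj E = Mat (\<lambda>u v. if E u v then 1 else 0)"

definition dual :: "('a \<Rightarrow> 'a \<Rightarrow> bool) \<Rightarrow> 'a \<Rightarrow> nat \<Rightarrow> 'a sqmat" where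
  "dual E x i = Mat (\<lambda>u v. if u = v \<and> gdist E x u = i then 1 else 0)"

lemma cmat_adj: "cmat (adj E) = adj_matrix E"
  by (simp add: cmat_def adj_def adj_matrix_def fun_eq_iff Mat_inverse)

lemma cmat_dual: "cmat (dual E x i) = dual_idem E x i"
  by (simp add: cmat_def dual_def dual_idem_def fun_eq_iff Mat_inverse)

text \<open>Conjugation is linear, and multiplicative by inserting \<open>mmult S R\<close>, so only
  the generators have to be checked.\<close>

lemma terwilliger_conjugate:
  assumes RS: "mmult S R = cmat 1"
    and adj: "mmult R (mmult (adj_matrix E) S) = adj_matrix E"
    and dual: "\<And>i. i \<le> D \<Longrightarrow> mmult R (mmult (dual_idem E x i) S) = dual_idem E y i"
    and M: "M \<in> terwilliger E D x"
  shows "mmult R (mmult M S) \<in> terwilliger E D y"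
  using M
proof induction
  case gen_adj
  then show ?case using terwilliger.gen_adj[of E D y] adj by simp
next
  case (gen_dual i)
  then show ?case using terwilliger.gen_dual[of i D E y] dual by simp
next
  case (add M N)
  then show ?case by (simp add: mmult_linear terwilliger.add)
next
  case (smult M c)
  then show ?case by (simp add: mmult_linear terwilliger.smult)
next
  case (mult M N)
  have "mmult R (mmult (mmult M N) S) = mmult (mmult R (mmult M (mmult S R))) (mmult N S)"
    by (simp add: RS mmult_cmat_1 mmult_assoc)
  also have "\<dots> = mmult (mmult R (mmult M S)) (mmult R (mmult N S))"
    by (simp add: mmult_assoc)
  finally show ?case using mult terwilliger.mult by metis
qed

text \<open>One real orthogonal matrix answers both demands: over the complex numbers it is the
  bijection on vectors, and conjugation by it is the algebra isomorphism, with inverse given by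
  \<open>tp \<rho>\<close>.\<close>

lemma pseudo_vertex_transitiveI:
  assumes "\<And>x y. \<exists>\<rho>. tp \<rho> * \<rho> = 1 \<and> \<rho> * tp \<rho> = 1 \<and> adj E * \<rho> = \<rho> * adj E \<and>
    (\<forall>i\<le>D. dual E y i * \<rho> = \<rho> * dual E x i)"
  shows "pseudo_vertex_transitive E D"
  unfolding pseudo_vertex_transitive_def
proof (intro allI)
  fix x y
  obtain \<rho> where "tp \<rho> * \<rho> = 1 \<and> \<rho> * tp \<rho> = 1 \<and> adj E * \<rho> = \<rho> * adj E \<and>
    (\<forall>i\<le>D. dual E y i * \<rho> = \<rho> * dual E x i)"
    using assms[of y x] by (rule exE) (rule that)
  then have \<rho>: "tp \<rho> * \<rho> = 1" "\<rho> * tp \<rho> = 1" "adj E * \<rho> = \<rho> * adj E"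
    "\<And>i. i \<le> D \<Longrightarrow> dual E y i * \<rho> = \<rho> * dual E x i"
    by simp_all
  define R S where "R = cmat \<rho>" "S = cmat (tp \<rho>)"
  have inv: "mmult S R = cmat 1" "mmult R S = cmat 1"
    using \<rho>(1,2) by (simp_all add: R_S_def cmat_mult)
  have A: "mmult (adj_matrix E) R = mmult R (adj_matrix E)"
    using \<rho>(3) by (simp add: R_S_def cmat_mult flip: cmat_adj)
  have D: "mmult (dual_idem E y i) R = mmult R (dual_idem E x i)" if "i \<le> D" for i
    using \<rho>(4)[OF that] by (simp add: R_S_def cmat_mult flip: cmat_dual)
  have conj: "mmult R (mmult N S) = M \<and> mmult S (mmult M R) = N"
    if "mmult M R = mmult R N" for M N
  proof
    have "mmult R (mmult N S) = mmult (mmult M R) S" by (simp add: mmult_assoc that)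
    then show "mmult R (mmult N S) = M" by (simp add: mmult_assoc inv mmult_cmat_1)
    have "mmult S (mmult R N) = N" by (simp add: inv mmult_cmat_1 flip: mmult_assoc)
    then show "mmult S (mmult M R) = N" by (simp add: that)
  qed
  note A1 = conj[OF A, THEN conjunct1] conj[OF A, THEN conjunct2]
  have D1: "mmult R (mmult (dual_idem E x i) S) = dual_idem E y i"
    "mmult S (mmult (dual_idem E y i) R) = dual_idem E x i" if "i \<le> D" for i
    using conj[OF D[OF that]] by auto
  let ?\<phi> = "\<lambda>M. mmult R (mmult M S)" and ?\<psi> = "\<lambda>M. mmult S (mmult M R)"
  have cancel: "mmult S (mmult R M) = M" "mmult R (mmult S M) = M" for M
    by (simp_all add: inv mmult_cmat_1 flip: mmult_assoc)
  have inverse: "?\<psi> (?\<phi> M) = M" "?\<phi> (?\<psi> M) = M" for M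
    by (simp_all add: mmult_assoc inv mmult_cmat_1 cancel)
  have "bij_betw ?\<phi> (terwilliger E D x) (terwilliger E D y)"
    using terwilliger_conjugate[OF inv(1) A1(1) D1(1)] terwilliger_conjugate[OF inv(2) A1(2) D1(2)]
    by (intro bij_betw_byWitness[where f' = ?\<psi>]) (auto simp: inverse)
  moreover have "?\<phi> (mmult M N) = mmult (?\<phi> M) (?\<phi> N)" for M N
  proof -
    have "mmult (?\<phi> M) (?\<phi> N) = mmult R (mmult M (mmult (mmult S R) (mmult N S)))"
      by (simp only: mmult_assoc)
    then show ?thesis by (simp add: inv mmult_cmat_1 mmult_assoc)
  qed
  ultimately have 1: "\<exists>\<phi>. bij_betw \<phi> (terwilliger E D x) (terwilliger E D y) \<and>
         (\<forall>M\<in>terwilliger E D x. \<forall>N\<in>terwilliger E D x. \<phi> (madd M N) = madd (\<phi> M) (\<phi> N)) \<and>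
         (\<forall>M\<in>terwilliger E D x. \<forall>c. \<phi> (msmult c M) = msmult c (\<phi> M)) \<and>
         (\<forall>M\<in>terwilliger E D x. \<forall>N\<in>terwilliger E D x. \<phi> (mmult M N) = mmult (\<phi> M) (\<phi> N)) \<and>
         \<phi> (adj_matrix E) = adj_matrix E \<and> (\<forall>i\<le>D. \<phi> (dual_idem E x i) = dual_idem E y i)"
    using A1(1) D1(1) by (intro exI[of _ ?\<phi>]) (simp add: mmult_linear)
  have "bij (mvec R)"
    by (rule bij_betw_byWitness[where f' = "mvec S"]) (auto simp: mvec_mvec inv mvec_cmat_1)
  then have 2: "\<exists>\<rho>. bij \<rho> \<and> (\<forall>f g. \<rho> (\<lambda>u. f u + g u) = (\<lambda>u. \<rho> f u + \<rho> g u)) \<and>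
         (\<forall>c f. \<rho> (\<lambda>u. c * f u) = (\<lambda>u. c * \<rho> f u)) \<and>
         (\<forall>f. \<rho> (mvec (adj_matrix E) f) = mvec (adj_matrix E) (\<rho> f)) \<and>
         (\<forall>i\<le>D. \<forall>f. \<rho> (mvec (dual_idem E x i) f) = mvec (dual_idem E y i) (\<rho> f))"
    by (intro exI[of _ "mvec R"])
      (simp add: mvec_mvec A D, simp add: mvec_def algebra_simps sum.distrib sum_distrib_left)
  show "(\<exists>\<phi> :: 'a cmat \<Rightarrow> 'a cmat.
         bij_betw \<phi> (terwilliger E D x) (terwilliger E D y) \<and>
         (\<forall>M\<in>terwilliger E D x. \<forall>N\<in>terwilliger E D x. \<phi> (madd M N) = madd (\<phi> M) (\<phi> N)) \<and>
         (\<forall>M\<in>terwilliger E D x. \<forall>c. \<phi> (msmult c M) = msmult c (\<phi> M)) \<and>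
         (\<forall>M\<in>terwilliger E D x. \<forall>N\<in>terwilliger E D x. \<phi> (mmult M N) = mmult (\<phi> M) (\<phi> N)) \<and>
         \<phi> (adj_matrix E) = adj_matrix E \<and>
         (\<forall>i\<le>D. \<phi> (dual_idem E x i) = dual_idem E y i)) \<and>
      (\<exists>\<rho> :: 'a cvec \<Rightarrow> 'a cvec.
         bij \<rho> \<and>
         (\<forall>f g. \<rho> (\<lambda>u. f u + g u) = (\<lambda>u. \<rho> f u + \<rho> g u)) \<and>
         (\<forall>c f. \<rho> (\<lambda>u. c * f u) = (\<lambda>u. c * \<rho> f u)) \<and>
         (\<forall>f. \<rho> (mvec (adj_matrix E) f) = mvec (adj_matrix E) (\<rho> f)) \<and>
         (\<forall>i\<le>D. \<forall>f. \<rho> (mvec (dual_idem E x i) f) = mvec (dual_idem E y i) (\<rho> f)))"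
    using 1 2 by (rule conjI)
qed

section \<open>Graph and matrix relations\<close>

lemma entry_dual_mult: "entry (dual E x i * M) u v = (if gdist E x u = i then entry M u v else 0)"
proof -
  have "entry (dual E x i * M) u v = (\<Sum>w\<in>UNIV. if u = w then (if gdist E x u = i then entry M u v else 0) else 0)"
    unfolding entry_mult by (intro sum.cong) (auto simp: dual_def)
  then show ?thesis by simp
qed

lemma tp_dual [simp]: "tp (dual E (x::'a::finite) i) = dual E x i"
  by (rule sqmat_eqI) (auto simp: dual_def)

lemma entry_mult_dual: "entry (M * dual E x i) u v = (if gdist E x v = i then entry M u v else 0)"
proof -
  have "entry (M * dual E x i) u v = entry (tp (M * dual E x i)) v u" by (simp del: tp_mult)
  then show ?thesis by (simp add: entry_dual_mult)
qed

section \<open>Distances, intersection numbers and the antipodal map\<close>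

locale at4 =
  fixes E :: "'a::finite \<Rightarrow> 'a \<Rightarrow> bool" and p q :: nat
  assumes AT4: "AT4 E p q"
begin

abbreviation d :: "'a \<Rightarrow> 'a \<Rightarrow> nat" where "d \<equiv> gdist E"

definition k :: real where "k = real q * (real p * real q + real p + real q)"
definition b1 :: real where "b1 = (real q ^ 2 - 1) * (real p + 1)"
definition c2 :: real where "c2 = real q * (real p + real q) / 2"
definition a1 :: real where "a1 = real p * (real q + 1)"

text \<open>The intersection array is continued by zero: \<open>bb 4 = 0\<close> and
  \<open>cc 0 = 0\<close> spare \<open>nbrs\<close> the boundary cases.\<close>

definition bb :: "nat \<Rightarrow> real" where
  "bb i = (if i = 0 then k else if i = 1 then b1 else if i = 2 then c2 else if i = 3 then 1 else 0)"
definition cc :: "nat \<Rightarrow> real" where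
  "cc i = (if i = 1 then 1 else if i = 2 then c2 else if i = 3 then b1 else if i = 4 then k else 0)"
text \<open>The tridiagonal intersection matrix; \<open>nbrs i j\<close> is to count the neighbours
  in level \<open>j\<close> of a vertex in level \<open>i\<close>.\<close>

definition nbrs :: "nat \<Rightarrow> nat \<Rightarrow> real" where
  "nbrs i j = (if j = Suc i then bb i else if i = Suc j then cc i else if i = j then k - bb i - cc i else 0)"

lemma p_ge: "1 \<le> real p" and q_ge: "2 \<le> real q"
  using AT4 by (auto simp: AT4_def)

lemma E_sym: "E u v \<Longrightarrow> E v u" and E_irrefl: "\<not> E u u"
  using AT4 by (auto simp: AT4_def distance_regular_array_def simple_graph_def)

lemma d_path: "(x, y) \<in> edge_rel E ^^ d x y"
proof -
  have "\<exists>n. (x, y) \<in> edge_rel E ^^ n"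
    using AT4 by (auto simp: AT4_def distance_regular_array_def connected_graph_def)
  then show ?thesis unfolding gdist_def by (rule LeastI_ex)
qed

lemma d_le: "(x, y) \<in> edge_rel E ^^ n \<Longrightarrow> d x y \<le> n"
  unfolding gdist_def by (rule Least_le)

lemma d_le_4: "d x y \<le> 4"
  using AT4 by (auto simp: AT4_def distance_regular_array_def has_diameter_def)

lemma d_eq_0: "d x y = 0 \<longleftrightarrow> x = y"
  using d_path[of x y] d_le[of x x 0] by auto

lemma d_self: "d x x = 0"
  by (simp add: d_eq_0)

lemma d_triangle: "d x z \<le> d x y + d y z"
  using d_path[of x y] d_path[of y z] by (intro d_le) (auto simp: relpow_add)

lemma relpow_edge_sym: "(x, y) \<in> edge_rel E ^^ n \<Longrightarrow> (y, x) \<in> edge_rel E ^^ n"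
proof (induction n arbitrary: y)
  case (Suc n)
  then obtain z where "(x, z) \<in> edge_rel E ^^ n" "(z, y) \<in> edge_rel E" by auto
  then have "(z, x) \<in> edge_rel E ^^ n" "(y, z) \<in> edge_rel E"
    using Suc.IH E_sym by (auto simp: edge_rel_def)
  then show ?case by (meson relpow_Suc_I2)
qed auto

lemma d_sym: "d x y = d y x"
  by (meson antisym d_le d_path relpow_edge_sym)

lemma E_iff_d: "E x y \<longleftrightarrow> d x y = 1"
proof
  assume "E x y"
  then have "d x y \<le> 1" "x \<noteq> y" using E_irrefl by (auto intro!: d_le simp: edge_rel_def)
  then show "d x y = 1" using d_eq_0[of x y] by linarith
next
  assume "d x y = 1"
  then show "E x y" using d_path[of x y] by (auto simp: edge_rel_def)
qed

lemma d_step: "E y z \<Longrightarrow> d x z \<le> Suc (d x y)"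
  using d_triangle[of x z y] by (simp add: E_iff_d)

lemma array:
  "d x y < 4 \<Longrightarrow> real (card {z. E y z \<and> d x z = d x y + 1}) = bb (d x y)"
  "1 \<le> d x y \<Longrightarrow> real (card {z. E y z \<and> d x z = d x y - 1}) = cc (d x y)"
proof -
  let ?bs = "[k, b1, c2, 1]" and ?cs = "[1, c2, b1, k]"
  have "distance_regular_array E 4 ?bs ?cs"
    using AT4 by (simp add: AT4_def k_def b1_def c2_def)
  then have D: "(d x y < 4 \<longrightarrow> real (card {z. E y z \<and> d x z = d x y + 1}) = ?bs ! d x y)"
    "(1 \<le> d x y \<longrightarrow> real (card {z. E y z \<and> d x z = d x y - 1}) = ?cs ! (d x y - 1))"
    unfolding distance_regular_array_def Let_def by blast+
  have cases: "i \<in> {0, 1, 2, 3, 4}" if "i \<le> 4" for i :: nat using that by auto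
  show "d x y < 4 \<Longrightarrow> real (card {z. E y z \<and> d x z = d x y + 1}) = bb (d x y)"
    using D(1) cases[OF d_le_4[of x y]] by (auto simp: bb_def numeral_eq_Suc)
  show "1 \<le> d x y \<Longrightarrow> real (card {z. E y z \<and> d x z = d x y - 1}) = cc (d x y)"
    using D(2) cases[OF d_le_4[of x y]] by (auto simp: cc_def numeral_eq_Suc)
qed

lemma degree: "real (card {z. E y z}) = k"
proof -
  have "{z. E y z} = {z. E y z \<and> d y z = d y y + 1}" by (auto simp: E_iff_d d_eq_0)
  moreover have "d y y = 0" by (simp add: d_eq_0)
  ultimately show ?thesis using array(1)[of y y] by (simp add: bb_def)
qed

text \<open>Neighbours of \<open>y\<close> lie at most one level off, and the degree fixes the
  number inside the level once those above and below are known.\<close>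

lemma card_nbrs: "real (card {z. E y z \<and> d x z = j}) = nbrs (d x y) j"
proof -
  let ?i = "d x y"
  have range: "j = Suc ?i \<or> ?i = Suc j \<or> ?i = j" if "E y z" "d x z = j" for z
    using d_step[OF that(1), of x] d_step[OF E_sym[OF that(1)], of x] that(2) by linarith
  have up: "real (card {z. E y z \<and> d x z = Suc ?i}) = bb ?i"
  proof (cases "?i < 4")
    case False
    then have "d x z \<noteq> Suc ?i" for z using d_le_4[of x z] by linarith
    moreover have "bb ?i = 0" using False by (auto simp: bb_def)
    ultimately show ?thesis by simp
  qed (use array(1) in auto)
  have down: "real (card {z. E y z \<and> Suc (d x z) = ?i}) = cc ?i"
  proof (cases "?i = 0")
    case False
    then have "{z. E y z \<and> Suc (d x z) = ?i} = {z. E y z \<and> d x z = ?i - 1}" by auto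
    then show ?thesis using False array(2)[of x y] by simp
  qed (auto simp: cc_def)
  have "{z. E y z} = {z. E y z \<and> d x z = ?i} \<union> ({z. E y z \<and> d x z = Suc ?i} \<union> {z. E y z \<and> Suc (d x z) = ?i})"
    using d_step[of y _ x] d_step[OF E_sym, of y _ x] by (auto simp: le_Suc_eq) (metis le_antisym le_Suc_eq)
  moreover have "card \<dots> = card {z. E y z \<and> d x z = ?i} +
      (card {z. E y z \<and> d x z = Suc ?i} + card {z. E y z \<and> Suc (d x z) = ?i})"
    by (simp add: card_Un_disjoint disjoint_iff)
  ultimately have level: "real (card {z. E y z \<and> d x z = ?i}) = k - bb ?i - cc ?i"
    using up down degree[of y] by simp
  consider "j = Suc ?i" | "?i = Suc j" | "?i = j" | "j \<noteq> Suc ?i" "?i \<noteq> Suc j" "?i \<noteq> j" by blast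
  then show ?thesis
  proof cases
    case 2
    then have "{z. E y z \<and> d x z = j} = {z. E y z \<and> Suc (d x z) = ?i}" by auto
    then show ?thesis using down 2 by (simp add: nbrs_def)
  next
    case 4
    then have "{z. E y z \<and> d x z = j} = {}" using range by blast
    then show ?thesis using 4 by (simp add: nbrs_def)
  qed (use up level in \<open>auto simp: nbrs_def\<close>)
qed

lemma k_pos: "0 < k" and b1_pos: "0 < b1" and c2_pos: "0 < c2"
proof -
  have "1 < real q ^ 2" using q_ge by (intro one_less_power) auto
  then show "0 < b1" using p_ge by (simp add: b1_def)
  show "0 < k" "0 < c2" using p_ge q_ge by (auto simp: k_def c2_def intro!: mult_pos_pos add_pos_pos)
qed

lemma ex_further:
  assumes "d x y < 4"
  obtains z where "E y z" "d x z = Suc (d x y)"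
proof -
  have "d x y \<in> {0,1,2,3}" using assms by auto
  then have "0 < bb (d x y)" using k_pos b1_pos c2_pos by (auto simp: bb_def)
  then have "{z. E y z \<and> d x z = Suc (d x y)} \<noteq> {}"
    using array(1)[OF assms] by (metis Suc_eq_plus1 card.empty less_irrefl of_nat_0)
  then show thesis using that by blast
qed

definition antipode :: "'a \<Rightarrow> 'a" where "antipode x = (THE y. d x y = 4)"

lemma d_eq_4: "d x y = 4 \<longleftrightarrow> y = antipode x"
proof -
  have "card {y. x = y \<or> d x y = 4} = 2"
    using AT4 by (auto simp: AT4_def antipodal_double_cover_def antipodal_rel_def Image_def)
  moreover have "{y. x = y \<or> d x y = 4} = insert x {y. d x y = 4}" "x \<notin> {y. d x y = 4}"
    using d_eq_0[of x x] by auto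
  ultimately have "card {y. d x y = 4} = 1" by simp
  then obtain z where "{y. d x y = 4} = {z}" by (rule card_1_singletonE)
  then have z: "d x y = 4 \<longleftrightarrow> y = z" for y by blast
  then show ?thesis by (simp add: antipode_def)
qed

text \<open>As \<open>bb i > 0\<close> for \<open>i < 4\<close>, every geodesic from
  \<open>x\<close> extends to distance 4, where \<open>antipode x\<close> is the only vertex. Hence
  every \<open>y\<close> lies on a geodesic from \<open>x\<close> to
  \<open>antipode x\<close>.\<close>

lemma d_antipode: "d (antipode x) y = 4 - d x y"
proof -
  have "d y (antipode x) \<le> 4 - d x y"
  proof (induction "4 - d x y" arbitrary: y)
    case 0
    then have "d x y = 4" using d_le_4[of x y] by simp
    then have "y = antipode x" by (rule d_eq_4[THEN iffD1])
    then have "d y (antipode x) = 0" by (rule d_eq_0[THEN iffD2])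
    then show ?case by simp
  next
    case (Suc n)
    from Suc.hyps(2) have "d x y < 4" by linarith
    then obtain z where z: "E y z" "d x z = Suc (d x y)" by (rule ex_further) (rule that)
    have "n = 4 - d x z" using Suc.hyps(2) z(2) by linarith
    then have "d z (antipode x) \<le> 4 - d x z" by (rule Suc.hyps(1))
    moreover have "d y (antipode x) \<le> 1 + d z (antipode x)"
      using d_triangle[of y "antipode x" z] z(1) E_iff_d by simp
    ultimately show ?case using Suc.hyps(2) z(2) by linarith
  qed
  moreover have "d x (antipode x) = 4" by (simp add: d_eq_4)
  then have "4 \<le> d x y + d y (antipode x)" using d_triangle[of x "antipode x" y] by simp
  ultimately show ?thesis using d_sym[of y] by simp
qed

lemma antipode_antipode: "antipode (antipode x) = x"
  using d_antipode[of x x] d_eq_0[of x x] d_eq_4[of "antipode x" x] by simp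

lemma antipode_eq: "antipode u = v \<longleftrightarrow> u = antipode v"
  using antipode_antipode by auto

lemma d_antipode2: "d x (antipode y) = 4 - d x y"
  using d_antipode[of y x] d_sym by simp

section \<open>The adjacency, all-ones and antipodal matrices\<close>

definition A :: "'a sqmat" where "A = adj E"
definition J :: "'a sqmat" where "J = Mat (\<lambda>u v. 1)"
definition Pi :: "'a sqmat" where "Pi = Mat (\<lambda>u v. if v = antipode u then 1 else 0)"

lemma tp_AJPi [simp]: "tp A = A" "tp J = J" "tp Pi = Pi"
  by (rule sqmat_eqI; auto simp: A_def adj_def J_def Pi_def antipode_antipode dest: E_sym)+

lemma entry_Pi_mult: "entry (Pi * M) u v = entry M (antipode u) v"
proof -
  have "entry (Pi * M) u v = (\<Sum>w\<in>UNIV. if antipode u = w then entry M (antipode u) v else 0)"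
    unfolding entry_mult by (intro sum.cong) (auto simp: Pi_def)
  then show ?thesis by simp
qed

lemma entry_mult_Pi: "entry (M * Pi) u v = entry M u (antipode v)"
proof -
  have "entry (M * Pi) u v = entry (tp (M * Pi)) v u" by (simp del: tp_mult)
  then show ?thesis by (simp add: entry_Pi_mult)
qed

lemma entry_A: "entry A u v = (if d u v = 1 then 1 else 0)"
  by (simp add: A_def adj_def E_iff_d)

lemma entry_J: "entry J u v = 1"
  by (simp add: J_def)

lemma entry_Pi: "entry Pi u v = (if v = antipode u then 1 else 0)"
  by (simp add: Pi_def)

lemma Pi_Pi: "Pi * Pi = 1"
  by (rule sqmat_eqI) (auto simp: entry_Pi_mult entry_Pi antipode_antipode)

lemma Pi_A: "Pi * A = A * Pi"
  by (rule sqmat_eqI) (simp add: entry_Pi_mult entry_mult_Pi entry_A d_antipode d_antipode2)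

lemma Pi_J: "Pi * J = J" and J_Pi: "J * Pi = J"
  by (rule sqmat_eqI; simp add: entry_Pi_mult entry_mult_Pi entry_J)+

text \<open>The distance matrices for 3 and 4 are \<open>A * Pi\<close> and \<open>Pi\<close>, so
  \<open>J - (1 + A) * (1 + Pi)\<close> is the one for distance 2, and this is the usual expansion
  of \<open>A * A\<close> in distance matrices.\<close>

lemma A_A: "A * A = k *\<^sub>R 1 + a1 *\<^sub>R A + c2 *\<^sub>R (J - (1 + A) * (1 + Pi))"
proof (rule sqmat_eqI)
  fix u v
  have "entry (A * A) u v = (\<Sum>w\<in>UNIV. if E v w \<and> d u w = 1 then 1 else 0)"
    unfolding entry_mult by (intro sum.cong) (auto simp: entry_A E_iff_d d_sym)
  also have "\<dots> = nbrs (d u v) 1" by (simp add: card_nbrs flip: sum.inter_filter)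
  finally have lhs: "entry (A * A) u v = nbrs (d u v) 1" .
  have Pi: "entry Pi u v = (if d u v = 4 then 1 else 0)" by (simp add: Pi_def d_eq_4)
  have APi: "entry (A * Pi) u v = (if d u v = 3 then 1 else 0)"
    using d_le_4[of u v] by (auto simp: entry_mult_Pi entry_A d_antipode2)
  have "k - b1 - 1 = a1" by (simp add: k_def b1_def a1_def algebra_simps power2_eq_square)
  moreover have "d u v \<in> {0,1,2,3,4}" using d_le_4[of u v] by auto
  ultimately show "entry (A * A) u v = entry (k *\<^sub>R 1 + a1 *\<^sub>R A + c2 *\<^sub>R (J - (1 + A) * (1 + Pi))) u v"
    unfolding lhs
    by (auto simp: distrib_left distrib_right Pi APi entry_A entry_J d_eq_0[symmetric] nbrs_def bb_def cc_def)
qed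

text \<open>The level sizes, written without a base vertex: level 2 is what levels 0, 1, 3 and 4
  leave over.\<close>

definition sz :: "nat \<Rightarrow> real" where
  "sz i = (if i = 0 \<or> i = 4 then 1 else if i = 1 \<or> i = 3 then k else if i = 2 then real CARD('a) - 2 - 2 * k else 0)"

end

section \<open>Blocks along the distance partition of a base vertex\<close>

locale at4_base = at4 +
  fixes x :: 'a
begin

definition V :: "nat \<Rightarrow> 'a sqmat" where "V i = dual E x i"

lemma tp_V [simp]: "tp (V i) = V i"
  by (simp add: V_def)

lemmas entry_V_mult = entry_dual_mult[of E x, folded V_def]
  and entry_mult_V = entry_mult_dual[of _ E x, folded V_def]

lemma entry_V: "entry (V i) u v = (if u = v \<and> d x u = i then 1 else 0)"
  by (simp add: V_def dual_def)

lemma V_V: "V i * V j = (if i = j then V i else 0)"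
  by (rule sqmat_eqI) (auto simp: entry_V_mult entry_V)

lemma V_sum: "V 0 + V 1 + V 2 + V 3 + V 4 = 1"
proof (rule sqmat_eqI)
  fix u v
  have "d x u \<in> {0,1,2,3,4}" using d_le_4[of x u] by auto
  then show "entry (V 0 + V 1 + V 2 + V 3 + V 4) u v = entry 1 u v" by (auto simp: entry_V)
qed

lemma V_A_V: "Suc i < j \<or> Suc j < i \<Longrightarrow> V i * (A * V j) = 0"
proof (rule sqmat_eqI)
  fix u v
  assume far: "Suc i < j \<or> Suc j < i"
  have "\<not> (d x u = i \<and> d x v = j \<and> d u v = 1)"
  proof
    assume *: "d x u = i \<and> d x v = j \<and> d u v = 1"
    then have "E u v" "E v u" using E_iff_d[of u v] E_sym[of u v] by simp_all
    then show False using d_step[of u v x] d_step[of v u x] * far by linarith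
  qed
  then show "entry (V i * (A * V j)) u v = entry 0 u v"
    by (simp add: entry_V_mult entry_mult_V entry_A)
qed

lemma Pi_V: "i \<le> 4 \<Longrightarrow> Pi * V i = V (4 - i) * Pi"
proof (rule sqmat_eqI)
  fix u v
  assume "i \<le> 4"
  then have "4 - d x v = 4 - i \<longleftrightarrow> d x v = i" using d_le_4[of x v] by linarith
  then show "entry (Pi * V i) u v = entry (V (4 - i) * Pi) u v"
    using antipode_eq[of u v]
    by (cases "u = antipode v") (simp_all add: entry_Pi_mult entry_mult_Pi entry_V d_antipode2 antipode_antipode)
qed

text \<open>The distance partition is equitable, with quotient matrix \<open>nbrs\<close>.\<close>

lemma V_A_V_J: "V j * (A * (V i * J)) = nbrs j i *\<^sub>R (V j * J)"
proof (rule sqmat_eqI)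
  fix u v
  have "entry (A * (V i * J)) u v = (\<Sum>w\<in>UNIV. if E u w \<and> d x w = i then 1 else 0)"
    unfolding entry_mult[of A] by (intro sum.cong) (auto simp: entry_A entry_V_mult entry_J E_iff_d)
  also have "\<dots> = nbrs (d x u) i" by (simp add: card_nbrs flip: sum.inter_filter)
  finally show "entry (V j * (A * (V i * J))) u v = entry (nbrs j i *\<^sub>R (V j * J)) u v"
    by (simp add: entry_V_mult entry_J)
qed

lemma card_level: "i \<le> 4 \<Longrightarrow> real (card {u. d x u = i}) = sz i"
proof -
  have 0: "real (card {u. d x u = 0}) = 1" by (simp add: d_eq_0)
  have 1: "real (card {u. d x u = 1}) = k" using degree[of x] by (simp add: E_iff_d)
  have "bij_betw antipode {u. d x u = i} {u. d x u = 4 - i}" if "i \<le> 4" for i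
    using that by (intro bij_betw_byWitness[where f' = antipode]) (auto simp: antipode_antipode d_antipode2)
  then have c: "card {u. d x u = i} = card {u. d x u = 4 - i}" if "i \<le> 4" for i
    using that bij_betw_same_card by blast
  have "(UNIV::'a set) = (\<Union>i\<in>{0,1,2,3,4}. {u. d x u = i})" using d_le_4[of x] by (fastforce simp: le_Suc_eq numeral_eq_Suc)
  then have "CARD('a) = card (\<Union>i\<in>{0,1,2,3,4}. {u. d x u = i})" by simp
  also have "\<dots> = (\<Sum>i\<in>{0,1,2,3,4}. card {u. d x u = i})" by (intro card_UN_disjoint) auto
  finally have "CARD('a) = card {u. d x u = 0} + card {u. d x u = 1} + card {u. d x u = 2}
      + card {u. d x u = 3} + card {u. d x u = 4}" by simp
  moreover have "card {u. d x u = 3} = card {u. d x u = 1}" "card {u. d x u = 4} = card {u. d x u = 0}"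
    using c[of 1] c[of 0] by simp_all
  moreover assume "i \<le> 4"
  then have "i \<in> {0,1,2,3,4}" by auto
  ultimately show ?thesis using 0 1 by (auto simp: sz_def)
qed

lemma sz_pos: "i \<le> 4 \<Longrightarrow> 0 < sz i"
proof -
  have "\<exists>u. d x u = i" if "i \<le> 4" for i
    using that
  proof (induction i)
    case 0
    then show ?case using d_eq_0 by blast
  next
    case (Suc i)
    then show ?case by (metis Suc_leD Suc_le_lessD ex_further)
  qed
  moreover assume "i \<le> 4"
  ultimately have "{u. d x u = i} \<noteq> {}" by blast
  then show ?thesis using card_level[OF \<open>i \<le> 4\<close>] by (metis card_gt_0_iff finite of_nat_0_less_iff)
qed

lemma J_V_J: "i \<le> 4 \<Longrightarrow> J * (V i * J) = sz i *\<^sub>R J"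
  by (rule sqmat_eqI) (simp add: entry_mult[of J] entry_V_mult entry_J card_level flip: sum.inter_filter)

lemma V0_J_V0: "V 0 * (J * V 0) = V 0"
  by (rule sqmat_eqI) (auto simp: entry_V_mult entry_mult_V entry_J entry_V d_eq_0)

lemma tr_V: "i \<le> 4 \<Longrightarrow> tr (V i) = sz i"
  by (simp add: tr_eq entry_V card_level flip: sum.inter_filter)

lemma tr_V_J: "i \<le> 4 \<Longrightarrow> tr (V i * J) = sz i"
  by (simp add: tr_eq entry_V_mult entry_J card_level flip: sum.inter_filter)

lemma tr_V_A: "tr (V i * A) = 0" and tr_V_Pi: "tr (V i * Pi) = 0" and tr_V_A_Pi: "tr (V i * (A * Pi)) = 0"
  by (auto simp: tr_eq entry_V_mult entry_V entry_mult_Pi entry_A d_antipode2 d_eq_4[symmetric] d_self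
    intro!: sum.neutral)

text \<open>The trace counts closed walks of length two in the local graph, which has
  \<open>k\<close> vertices and valency \<open>a1\<close>.\<close>

lemma tr_local_square: "tr (V 1 * A * V 1 * (V 1 * A * V 1)) = a1 * k"
proof -
  have "entry (V 1 * A * V 1 * (V 1 * A * V 1)) u u = (if d x u = 1 then a1 else 0)" for u
  proof -
    have "entry (V 1 * A * V 1 * (V 1 * A * V 1)) u u
        = (\<Sum>w\<in>UNIV. if E u w \<and> d x w = 1 then (if d x u = 1 then 1 else 0) else 0)"
      unfolding entry_mult[of "V 1 * A * V 1"]
      by (intro sum.cong) (auto simp: entry_mult_V entry_V_mult entry_A E_iff_d d_sym)
    also have "\<dots> = (if d x u = 1 then nbrs 1 1 else 0)"
      using card_nbrs[of u x 1] by (simp flip: sum.inter_filter)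
    finally show ?thesis
      by (simp add: nbrs_def bb_def cc_def k_def b1_def a1_def algebra_simps power2_eq_square)
  qed
  then have "tr (V 1 * A * V 1 * (V 1 * A * V 1)) = (\<Sum>u\<in>UNIV. if d x u = 1 then a1 else 0)"
    by (simp add: tr_eq)
  also have "\<dots> = a1 * k" using card_level[of 1] by (simp add: sz_def flip: sum.inter_filter)
  finally show ?thesis .
qed

end

section \<open>The local graph\<close>

context at4_base
begin

declare One_nat_def [simp del]

lemma V_V_ext: "V i * (V j * Y) = (if i = j then V i * Y else 0)"
  by (simp add: V_V flip: mult.assoc)

lemma V_far: "i + 1 < j \<or> j + 1 < i \<Longrightarrow> V i * (A * V j) = 0"
  by (rule V_A_V) auto

lemma V_far_ext: "i + 1 < j \<or> j + 1 < i \<Longrightarrow> V i * (A * (V j * Y)) = 0"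
  using V_far[of i j] by (metis mult.assoc mult_zero_left)

lemma Pi_V_ext: "i \<le> 4 \<Longrightarrow> Pi * (V i * Y) = V (4 - i) * (Pi * Y)"
  by (simp add: Pi_V flip: mult.assoc)

lemma J_V_A_V: "J * (V i * (A * V j)) = nbrs j i *\<^sub>R (J * V j)"
  using arg_cong[OF V_A_V_J[of j i], of tp] by (simp add: mult.assoc)

lemma J_V_Pi: "i \<le> 4 \<Longrightarrow> J * (V i * Pi) = J * V (4 - i)"
  using Pi_V[of "4 - i"] J_Pi by (metis diff_diff_cancel diff_le_self mult.assoc)

lemma ext_rels:
  "Pi * (Pi * Y) = Y" "Pi * (A * Y) = A * (Pi * Y)" "Pi * (J * Y) = J * Y" "J * (Pi * Y) = J * Y"
  "V j * (A * (V i * (J * Y))) = nbrs j i *\<^sub>R (V j * (J * Y))"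
  "J * (V i * (A * (V j * Y))) = nbrs j i *\<^sub>R (J * (V j * Y))"
  "i \<le> 4 \<Longrightarrow> J * (V i * (J * Y)) = sz i *\<^sub>R (J * Y)"
  "V 0 * (J * (V 0 * Y)) = V 0 * Y"
  "i \<le> 4 \<Longrightarrow> J * (V i * (Pi * Y)) = J * (V (4 - i) * Y)"
  using mult_ext[OF Pi_Pi, of Y] mult_ext[OF Pi_A, of Y] mult_ext[OF Pi_J, of Y] mult_ext[OF J_Pi, of Y]
    arg_cong[OF V_A_V_J[of j i], of "\<lambda>Z. Z * Y"] arg_cong[OF J_V_A_V[of i j], of "\<lambda>Z. Z * Y"]
    arg_cong[OF J_V_J[of i], of "\<lambda>Z. Z * Y"] arg_cong[OF V0_J_V0, of "\<lambda>Z. Z * Y"]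
    arg_cong[OF J_V_Pi[of i], of "\<lambda>Z. Z * Y"]
  by (simp_all add: mult.assoc)

lemma nbrs_values: "nbrs 0 1 = k" "nbrs 1 0 = 1" "nbrs 1 1 = a1" "nbrs 1 2 = b1" "nbrs 2 1 = c2" "nbrs 2 2 = k - 2 * c2"
  by (simp_all add: nbrs_def bb_def cc_def a1_def k_def b1_def algebra_simps power2_eq_square)

lemma sz_values: "sz 0 = 1" "sz 1 = k" "sz 3 = k" "sz 4 = 1"
  by (simp_all add: sz_def)

text \<open>As rewrite rules these move \<^term>\<open>Pi\<close> to the right end of every product.\<close>
lemmas rels = mult.assoc V_V V_V_ext V_far V_far_ext Pi_V Pi_V_ext V_A_V_J J_V_A_V J_V_J V0_J_V0 J_V_Pi ext_rels
  Pi_Pi Pi_A Pi_J J_Pi nbrs_values sz_values One_nat_def[symmetric]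

lemma split_V: "V 0 * M + V 1 * M + V 2 * M + V 3 * M + V 4 * M = M"
  by (simp add: V_sum flip: distrib_right)

text \<open>\<open>B\<close> and \<open>C\<close> are the adjacency matrices of the first and second
  subconstituent, \<open>G\<close> and \<open>H\<close> hold the edges between them, and
  \<open>Q\<close> projects onto the vectors on level 1 with coordinate sum zero.\<close>

definition B :: "'a sqmat" where "B = V 1 * (A * V 1)"
definition G :: "'a sqmat" where "G = V 2 * (A * V 1)"
definition H :: "'a sqmat" where "H = V 1 * (A * V 2)"
definition C :: "'a sqmat" where "C = V 2 * (A * V 2)"
definition J1 :: "'a sqmat" where "J1 = V 1 * (J * V 1)"
definition Q :: "'a sqmat" where "Q = V 1 - (1 / k) *\<^sub>R J1"

lemmas block_defs = B_def G_def H_def C_def J1_def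

lemma tp_blocks [simp]: "tp B = B" "tp C = C" "tp G = H" "tp H = G" "tp J1 = J1" "tp Q = Q"
  by (simp_all add: block_defs Q_def mult.assoc)

lemma A_V0: "V 1 * (A * V 0) = V 1 * (J * V 0)"
  using arg_cong[OF V_A_V_J[of 1 0], of "\<lambda>Z. Z * V 0"] V0_J_V0 by (simp add: nbrs_values mult.assoc)

lemma A_V1: "A * V 1 = V 0 * (J * V 1) + B + G"
proof -
  have "V 0 * (A * V 1) = V 0 * (J * V 1)" using arg_cong[OF A_V0, of tp] by (simp add: mult.assoc)
  then show ?thesis using split_V[of "A * V 1"] by (simp add: rels block_defs)
qed

lemma A_V2: "A * V 2 = H + C + V 3 * (A * V 2)"
  using split_V[of "A * V 2"] by (simp add: rels block_defs)

lemma A_A_mult: "A * (A * M) = k *\<^sub>R M + a1 *\<^sub>R (A * M) + c2 *\<^sub>R (J * M - (M + A * M) - (Pi * M + A * (Pi * M)))"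
  using arg_cong[OF A_A, of "\<lambda>Z. Z * M"] by (simp add: algebra_simps)

text \<open>The level 1 block of \<open>A * A\<close> is computed twice: from \<open>A_A\<close>,
  and by splitting walks of length two according to the level 0, 1 or 2 of the middle
  vertex.\<close>

lemma H_G: "H * G = (k - c2) *\<^sub>R V 1 + (a1 - c2) *\<^sub>R B - B * B + (c2 - 1) *\<^sub>R J1"
proof -
  have "V 1 * (A * (A * V 1)) = (k - c2) *\<^sub>R V 1 + (a1 - c2) *\<^sub>R B + c2 *\<^sub>R J1"
    unfolding A_A_mult by (simp add: rels block_defs algebra_simps)
  moreover have "V 1 * (A * (A * V 1)) = J1 + B * B + H * G"
    by (subst A_V1) (simp add: rels block_defs algebra_simps)
  ultimately show ?thesis by (simp add: algebra_simps)
qed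

text \<open>The same for the block of \<open>A * A\<close> between levels 1 and 3. Here the middle
  vertex is in level 2, and \<open>Pi\<close> identifies level 3 with level 1.\<close>

lemma H_Pi_G: "H * (Pi * G) = c2 *\<^sub>R (J1 - V 1 - B)"
proof -
  have "V 1 * (A * (A * (V 3 * Pi))) = c2 *\<^sub>R (J1 - V 1 - B)"
    unfolding A_A_mult by (simp add: rels block_defs algebra_simps)
  moreover have "V 1 * (A * (A * (V 3 * Pi))) = H * (Pi * G)"
    using arg_cong[OF split_V[of "A * (V 3 * Pi)"], of "\<lambda>Z. V 1 * (A * Z)"]
    by (simp add: rels block_defs distrib_left)
  ultimately show ?thesis by simp
qed

lemma block_rels:
  "V 1 * B = B" "B * V 1 = B" "B * J1 = a1 *\<^sub>R J1" "J1 * B = a1 *\<^sub>R J1" "J1 * J1 = k *\<^sub>R J1"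
  "V 1 * J1 = J1" "J1 * V 1 = J1" "G * V 1 = G" "V 2 * G = G" "V 1 * H = H" "H * V 2 = H"
  by (simp_all add: rels block_defs)

lemma Q_rels:
  "Q * Q = Q" "B * Q = Q * B" "J1 * Q = 0" "V 1 * Q = Q" "J * Q = 0" "Q * V 1 = Q"
  using k_pos by (simp_all add: Q_def algebra_simps V_V block_rels) (simp add: rels J1_def)

lemma sym_idem_Q: "sym_idem Q"
  by (simp add: sym_idem_def Q_rels)

text \<open>\<open>Q\<close> removes the all-ones vector of level 1, on which \<open>B\<close> has
  eigenvalue \<open>a1\<close>. Its contributions 1, \<open>a1\<close> and \<open>a1\<^sup>2\<close>
  are subtracted from the full traces \<open>k\<close>, 0 and \<open>a1 * k\<close>.\<close>

lemma tr_Q: "tr Q = k - 1" and tr_B_Q: "tr (B * Q) = - a1" and tr_B_B_Q: "tr (B * (B * Q)) = a1 * k - a1\<^sup>2"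
proof -
  have J1: "tr J1 = k"
    unfolding J1_def by (subst tr_commute) (simp add: rels tr_commute[of J] tr_V_J)
  have B: "tr B = 0"
    unfolding B_def by (subst tr_commute) (simp add: rels tr_commute[of A] tr_V_A)
  have BB: "tr (B * B) = a1 * k" using tr_local_square by (simp add: B_def mult.assoc)
  show "tr Q = k - 1" using J1 k_pos by (simp add: Q_def tr_V sz_values)
  show "tr (B * Q) = - a1" using J1 B k_pos by (simp add: Q_def right_diff_distrib block_rels)
  show "tr (B * (B * Q)) = a1 * k - a1\<^sup>2"
    using J1 BB k_pos by (simp add: Q_def right_diff_distrib block_rels power2_eq_square)
qed

text \<open>As \<open>Pi\<close> is a symmetric involution, the Gram matrix of
  \<open>(1 + \<sigma> *\<^sub>R Pi) * (G * Y)\<close> is twice the matrix under the trace. Both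
  signs of \<sigma> are used.\<close>

lemma tr_gram_nonneg:
  assumes "\<sigma> * \<sigma> = 1" "tp Y = Y"
  shows "0 \<le> tr (Y * ((H * G + \<sigma> *\<^sub>R (H * (Pi * G))) * Y))"
proof -
  have "tp (G * Y + \<sigma> *\<^sub>R (Pi * (G * Y))) * (G * Y + \<sigma> *\<^sub>R (Pi * (G * Y)))
      = 2 *\<^sub>R (Y * ((H * G + \<sigma> *\<^sub>R (H * (Pi * G))) * Y))"
    using assms by (simp add: algebra_simps ext_rels scaleR_2 Pi_Pi) (rule sqmat_eqI, simp)
  then have "2 * tr (Y * ((H * G + \<sigma> *\<^sub>R (H * (Pi * G))) * Y)) \<ge> 0"
    using tr_tp_mult_nonneg[of "G * Y + \<sigma> *\<^sub>R (Pi * (G * Y))"] by simp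
  then show ?thesis by simp
qed

text \<open>The eigenvalue of \<open>A\<close> that accompanies \<open>- q\<close> on the skew half
  under \<open>Pi\<close>: the two have sum \<open>a1\<close> and product
  \<open>- k\<close>.\<close>

definition \<theta> :: real where "\<theta> = real p * real q + real p + real q"

lemma parameter_ids: "k = real q * \<theta>" "a1 = \<theta> - real q" "k - 2 * c2 = real p * (real q)\<^sup>2"
  "a1 - 2 * c2 = real p - (real q)\<^sup>2"
  by (simp_all add: k_def a1_def c2_def \<theta>_def algebra_simps power2_eq_square)

text \<open>Both Gram matrices \<open>G\<^sup>T (1 \<plusminus> \<Pi>) G\<close> are quadratic polynomials in \<^term>\<open>B\<close>, so the eigenvalues of
  \<^term>\<open>B\<close> on the range of \<^term>\<open>Q\<close> lie in \<open>[-q, p]\<close>; the average of \<open>(p - \<eta>)(\<eta> + q)\<close> over them is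
  zero, so they all equal \<open>p\<close> or \<open>-q\<close>. The identity \<open>certificate\<close> replaces the eigenvalue argument.\<close>

lemma local_quadratic:
  "B * (B * Q) = (real p + - real q) *\<^sub>R (B * Q) - (real p * - real q) *\<^sub>R Q"
proof -
  define P q' T where "P = real p" and "q' = real q" and "T = B * Q"
  have T: "Q * T = T" "T * Q = T" "tp T = T" "Q * Q = Q" "T * T = B * (B * Q)"
    unfolding T_def using Q_rels block_rels by (simp_all add: mult.assoc) (metis Q_rels(1,2) mult.assoc)+
  have T': "Q * (T * Y) = T * Y" "T * (Q * Y) = T * Y" "Q * (Q * Y) = Q * Y" for Y
    using T by (simp_all add: mult_ext)
  \<comment> \<open>At an eigenvalue \<eta> of \<open>T\<close> on the range of \<open>Q\<close>,
    this Gram matrix has the value \<open>(P - \<eta>) * (\<eta> + q'\<^sup>2)\<close>, and the next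
    one has \<open>(\<theta> - \<eta>) * (\<eta> + q')\<close>. The first gives the upper bound
    \<open>P\<close>, the second the lower bound \<open>- q'\<close>.\<close>
  have plus: "Q * ((H * G + 1 *\<^sub>R (H * (Pi * G))) * Q) = (P * q'\<^sup>2) *\<^sub>R Q + (P - q'\<^sup>2) *\<^sub>R T - T * T"
  proof -
    have "H * G + H * (Pi * G) = (k - 2 * c2) *\<^sub>R V 1 + (a1 - 2 * c2) *\<^sub>R B - B * B + (2 * c2 - 1) *\<^sub>R J1"
      unfolding H_G H_Pi_G by (rule sqmat_eqI) (simp add: algebra_simps)
    then have "(H * G + 1 *\<^sub>R (H * (Pi * G))) * Q = (P * q'\<^sup>2) *\<^sub>R Q + (P - q'\<^sup>2) *\<^sub>R T - T * T"
      unfolding parameter_ids(3,4) P_def q'_def T(5) by (simp add: distrib_right left_diff_distrib Q_rels mult.assoc T_def)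
    then show ?thesis by (simp add: distrib_left right_diff_distrib T(1-4) T')
  qed
  have minus: "Q * ((H * G + (-1) *\<^sub>R (H * (Pi * G))) * Q) = (q' * \<theta>) *\<^sub>R Q + (\<theta> - q') *\<^sub>R T - T * T"
  proof -
    have "H * G + (-1) *\<^sub>R (H * (Pi * G)) = k *\<^sub>R V 1 + a1 *\<^sub>R B - B * B - J1"
      unfolding H_G H_Pi_G by (rule sqmat_eqI) (simp add: algebra_simps)
    then have "(H * G + (-1) *\<^sub>R (H * (Pi * G))) * Q = (q' * \<theta>) *\<^sub>R Q + (\<theta> - q') *\<^sub>R T - T * T"
      unfolding parameter_ids(1,2) P_def q'_def T(5) by (simp add: distrib_right left_diff_distrib Q_rels mult.assoc T_def)
    then show ?thesis by (simp add: distrib_left right_diff_distrib T(1-4) T')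
  qed
  define Y1 Y2 M where "Y1 = P *\<^sub>R Q - T" and "Y2 = T + q' *\<^sub>R Q"
    and "M = (P * q') *\<^sub>R Q + (P - q') *\<^sub>R T - T * T"
  have QY: "Y1 * Q = Y1" "Q * Y1 = Y1" "Y2 * Q = Y2" "Q * Y2 = Y2"
    by (simp_all add: Y1_def Y2_def left_diff_distrib right_diff_distrib distrib_left distrib_right T)
  have g1: "0 \<le> tr (Y1 * (((q' * \<theta>) *\<^sub>R Q + (\<theta> - q') *\<^sub>R T - T * T) * Y1))"
  proof -
    have "tp Y1 = Y1" by (simp add: Y1_def T)
    moreover have "Y1 * ((Q * ((H * G + (-1) *\<^sub>R (H * (Pi * G))) * Q)) * Y1)
        = Y1 * ((H * G + (-1) *\<^sub>R (H * (Pi * G))) * Y1)"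
      by (simp only: mult.assoc QY mult_ext[OF QY(1)])
    ultimately show ?thesis using tr_gram_nonneg[of "-1" Y1] unfolding minus by simp
  qed
  have g2: "0 \<le> tr (Y2 * (((P * q'\<^sup>2) *\<^sub>R Q + (P - q'\<^sup>2) *\<^sub>R T - T * T) * Y2))"
  proof -
    have "tp Y2 = Y2" by (simp add: Y2_def T)
    moreover have "Y2 * ((Q * ((H * G + 1 *\<^sub>R (H * (Pi * G))) * Q)) * Y2)
        = Y2 * ((H * G + 1 *\<^sub>R (H * (Pi * G))) * Y2)"
      by (simp only: mult.assoc QY mult_ext[OF QY(3)])
    ultimately show ?thesis using tr_gram_nonneg[of "1" Y2] unfolding plus by simp
  qed
  \<comment> \<open>In terms of \<eta>, the arguments of the three traces on the right are
    \<open>(P - \<eta>) * (\<eta> + q')\<close>, the value of \<open>M\<close>, times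
    \<open>(P - \<eta>) * (\<theta> - \<eta>)\<close>,
    \<open>(\<eta> + q') * (\<eta> + q'\<^sup>2)\<close> and
    \<open>(P - \<eta>) * (\<eta> + q')\<close>. The weights are chosen so that \<eta> and its
    square cancel in the weighted sum of these factors, leaving the constant on the left.\<close>
  have certificate: "((q'\<^sup>2 + P) * P * \<theta> + (\<theta> + q') * q' ^ 3 + (q'\<^sup>2 + P + (\<theta> + q')) * P * q') * tr M
     = (q'\<^sup>2 + P) * tr (Y1 * (((q' * \<theta>) *\<^sub>R Q + (\<theta> - q') *\<^sub>R T - T * T) * Y1))
     + (\<theta> + q') * tr (Y2 * (((P * q'\<^sup>2) *\<^sub>R Q + (P - q'\<^sup>2) *\<^sub>R T - T * T) * Y2))
     + (q'\<^sup>2 + P + (\<theta> + q')) * tr (M * M)"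
    unfolding Y1_def Y2_def M_def
    by (simp add: left_diff_distrib right_diff_distrib distrib_left distrib_right T(1-4) T' mult.assoc)
      (simp add: algebra_simps power2_eq_square power3_eq_cube)
  have "tr M = P * q' * (k - 1) + (P - q') * (- a1) - (a1 * k - a1\<^sup>2)"
    unfolding M_def T(5) by (simp add: T_def tr_Q tr_B_Q tr_B_B_Q)
  also have "\<dots> = 0" by (simp add: P_def q'_def k_def a1_def algebra_simps power2_eq_square)
  finally have "tr M = 0" .
  moreover have "0 < q'\<^sup>2 + P" "0 < \<theta> + q'"
    using p_ge q_ge by (auto simp: P_def q'_def \<theta>_def intro!: add_pos_pos mult_pos_pos)
  moreover have tp_M: "tp M = M" by (simp add: M_def T(1-4))
  then have "0 \<le> tr (M * M)" using tr_tp_mult_nonneg[of M] by simp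
  ultimately have "tr (M * M) \<le> 0"
    using certificate g1 g2
    by (smt (verit, best) mult_nonneg_nonneg mult_pos_pos mult_zero_right zero_less_mult_iff)
  with \<open>0 \<le> tr (M * M)\<close> have "tr (tp M * M) = 0" by (simp add: tp_M)
  then have "M = 0" by (rule tr_tp_mult_eq_0)
  then show ?thesis unfolding M_def T(5) unfolding T_def P_def q'_def by (simp add: algebra_simps)
qed

end

section \<open>Modules with local support\<close>

lemma sum_atMost_4: "(\<Sum>i\<in>{..4::nat}. f i) = f 0 + f 1 + f 2 + f 3 + (f 4 :: 'b::comm_monoid_add)"
  by (simp add: eval_nat_numeral)

lemma sum_lessThan_3: "(\<Sum>i\<in>{..<3::nat}. f i) = f 0 + f 1 + (f 2 :: 'b::comm_monoid_add)"
  by (simp add: eval_nat_numeral)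

context at4_base
begin

text \<open>Here \<open>\<eta>\<close> is an eigenvalue of the local graph and \<open>\<sigma>\<close> is the eigenvalue of \<^term>\<open>Pi\<close> on the image of
  its eigenspace in the second subconstituent; the image in the other eigenspace of \<^term>\<open>Pi\<close> vanishes
  because of the equation for \<open>\<eta>\<close>.\<close>

definition local_module :: "'a sqmat \<Rightarrow> real \<Rightarrow> real \<Rightarrow> bool" where
  "local_module P \<eta> \<sigma> \<longleftrightarrow> sym_idem P \<and> V 1 * P = P \<and> J * P = 0 \<and> B * P = \<eta> *\<^sub>R P \<and> \<sigma> * \<sigma> = 1 \<and>
     k - c2 + (a1 - c2) * \<eta> - \<eta>\<^sup>2 = - \<sigma> * c2 * (1 + \<eta>) \<and> \<eta> \<noteq> - 1"

text \<open>\<open>\<zeta> \<eta> \<sigma>\<close> will be the eigenvalue of \<open>C\<close> on the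
  image of \<open>G * P\<close>, and \<open>\<gamma> \<eta> \<sigma>\<close> below the factor by
  which \<open>G\<close> scales squared lengths on the range of \<open>P\<close>.\<close>

definition \<zeta> :: "real \<Rightarrow> real \<Rightarrow> real" where "\<zeta> \<eta> \<sigma> = a1 - c2 * (1 + \<sigma>) - \<eta>"

definition \<gamma> :: "real \<Rightarrow> real \<Rightarrow> real" where "\<gamma> \<eta> \<sigma> = - \<sigma> * c2 * (1 + \<eta>)"

lemma local_moduleD:
  assumes "local_module P \<eta> \<sigma>"
  shows "P * P = P" "tp P = P" "V 1 * P = P" "P * V 1 = P" "J * P = 0" "B * P = \<eta> *\<^sub>R P" "\<sigma> * \<sigma> = 1" "\<gamma> \<eta> \<sigma> \<noteq> 0"
proof -
  show 1: "P * P = P" "tp P = P" "V 1 * P = P" "J * P = 0" "B * P = \<eta> *\<^sub>R P" "\<sigma> * \<sigma> = 1"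
    using assms by (auto simp: local_module_def sym_idem_def)
  show "P * V 1 = P" using arg_cong[OF 1(3), of tp] 1(2) by simp
  show "\<gamma> \<eta> \<sigma> \<noteq> 0" using assms c2_pos 1(6) by (auto simp: \<gamma>_def local_module_def)
qed

lemma local_module_action:
  assumes "local_module P \<eta> \<sigma>"
  shows "H * (G * P) = \<gamma> \<eta> \<sigma> *\<^sub>R P" "Pi * (G * P) = \<sigma> *\<^sub>R (G * P)" "C * (G * P) = \<zeta> \<eta> \<sigma> *\<^sub>R (G * P)"
proof -
  note P = local_moduleD[OF assms]
  have J1: "J1 * P = 0" using P(3,5) by (simp add: J1_def mult.assoc)
  show 1: "H * (G * P) = \<gamma> \<eta> \<sigma> *\<^sub>R P"
  proof -
    have "H * (G * P) = (k - c2 + (a1 - c2) * \<eta> - \<eta>\<^sup>2) *\<^sub>R P"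
      using arg_cong[OF H_G, of "\<lambda>Z. Z * P"] P J1
      by (simp add: mult.assoc distrib_right left_diff_distrib scaleR_left_distrib scaleR_left_diff_distrib
          power2_eq_square)
    then show ?thesis using assms by (simp add: local_module_def \<gamma>_def)
  qed
  have 2: "H * (Pi * (G * P)) = (\<sigma> * \<gamma> \<eta> \<sigma>) *\<^sub>R P"
  proof -
    have "H * (Pi * (G * P)) = (- c2 * (1 + \<eta>)) *\<^sub>R P"
      using arg_cong[OF H_Pi_G, of "\<lambda>Z. Z * P"] P J1
      by (simp add: mult.assoc distrib_left left_diff_distrib scaleR_left_distrib scaleR_left_diff_distrib
          scaleR_right_diff_distrib)
    moreover have "\<sigma> * \<gamma> \<eta> \<sigma> = - c2 * (1 + \<eta>)" using P(7) by (simp add: \<gamma>_def algebra_simps) (simp add: mult.assoc[symmetric])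
    ultimately show ?thesis by simp
  qed
  \<comment> \<open>\<open>H * (Pi * (G * P))\<close> is \<sigma> times \<open>H * (G * P)\<close>,
    so the Gram matrix of this difference vanishes and \<open>G * P\<close> maps into one eigenspace
    of \<open>Pi\<close>.\<close>
  let ?Z = "Pi * (G * P) - \<sigma> *\<^sub>R (G * P)"
  have "tp ?Z * ?Z = P * (H * (G * P)) - (2 * \<sigma>) *\<^sub>R (P * (H * (Pi * (G * P)))) + (\<sigma> * \<sigma>) *\<^sub>R (P * (H * (G * P)))"
    using P(2) by (simp add: algebra_simps ext_rels Pi_Pi) (rule sqmat_eqI, simp)
  also have "\<dots> = 0" unfolding 1 2 using P(1,7)
    by (simp add: algebra_simps) (rule sqmat_eqI, simp add: algebra_simps)
  finally have "?Z = 0" by (rule tp_mult_eq_0)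
  then show 3: "Pi * (G * P) = \<sigma> *\<^sub>R (G * P)" by simp
  have GP: "V 2 * (A * P) = G * P" by (metis G_def P(3) mult.assoc)
  have PiGP: "V 2 * (A * (Pi * P)) = Pi * (G * P)"
  proof -
    have "Pi * (G * P) = V 2 * (A * (Pi * (V 1 * P)))" by (simp add: rels G_def)
    then show ?thesis using P(3) by simp
  qed
  have PiP: "V 2 * P = 0" "V 2 * (Pi * P) = 0"
  proof -
    have "V 2 * (V 1 * P) = 0" "V 2 * (Pi * (V 1 * P)) = 0" by (simp_all add: rels)
    then show "V 2 * P = 0" "V 2 * (Pi * P) = 0" using P(3) by simp_all
  qed
  \<comment> \<open>The level 2 part of \<open>A * (A * P)\<close> is computed from
    \<open>A_A\<close> and then by following walks through levels 1 and 2; the comparison yields the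
    eigenvalue of \<open>C\<close>.\<close>
  have "V 2 * (A * (A * P)) = (a1 - c2 * (1 + \<sigma>)) *\<^sub>R (G * P)"
    unfolding A_A_mult
    by (simp add: distrib_left right_diff_distrib P(5) PiP GP PiGP 3) (rule sqmat_eqI, simp add: algebra_simps)
  moreover have "V 2 * (A * (A * P)) = \<eta> *\<^sub>R (G * P) + C * (G * P)"
  proof -
    have "A * P = V 0 * (J * P) + B * P + G * P"
      using arg_cong[OF A_V1, of "\<lambda>Z. Z * P"] P(3) by (simp add: mult.assoc distrib_right)
    then have "A * P = \<eta> *\<^sub>R P + G * P" using P(5,6) by simp
    moreover have "V 2 * (A * (G * P)) = C * (G * P)" by (simp add: rels C_def G_def)
    moreover have "V 2 * (A * (\<eta> *\<^sub>R P + G * P)) = \<eta> *\<^sub>R (G * P) + V 2 * (A * (G * P))"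
      by (simp add: distrib_left GP)
    ultimately show ?thesis by (simp only:)
  qed
  ultimately show "C * (G * P) = \<zeta> \<eta> \<sigma> *\<^sub>R (G * P)"
    unfolding \<zeta>_def by (metis add_diff_cancel_left' scaleR_left_diff_distrib)
qed

lemma local_module_action_tp:
  assumes "local_module P \<eta> \<sigma>"
  shows "P * (H * G) = \<gamma> \<eta> \<sigma> *\<^sub>R P" "P * (H * Pi) = \<sigma> *\<^sub>R (P * H)" "P * (H * C) = \<zeta> \<eta> \<sigma> *\<^sub>R (P * H)"
  using local_module_action[OF assms, THEN arg_cong, of tp] local_moduleD(2)[OF assms]
  by (simp_all add: mult.assoc)

section \<open>The primary module and the three-dimensional local modules\<close>

definition gens :: "nat option \<Rightarrow> 'a sqmat" where
  "gens o' = (case o' of None \<Rightarrow> A | Some i \<Rightarrow> V i)"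

lemma tp_gens: "tp (gens l) = gens l"
  by (simp add: gens_def split: option.split)

definition primary_action :: "nat option \<Rightarrow> nat \<Rightarrow> nat \<Rightarrow> real" where
  "primary_action l i j = (case l of None \<Rightarrow> nbrs i j | Some l \<Rightarrow> if i = l \<and> j = l then 1 else 0)"

text \<open>The range of \<open>V 0\<close> is the line of the base vertex, and
  \<open>V i * (J * V 0)\<close> sends that vertex to the characteristic vector of level
  \<open>i\<close>. The span of these vectors is invariant because the partition is
  equitable.\<close>

lemma primary_module: "thin_module gens (V 0) {..4} (\<lambda>i. V i * (J * V 0)) sz primary_action"
  unfolding thin_module_def
proof (intro conjI ballI allI)
  fix l j assume j: "j \<in> {..4::nat}"
  show "gens l * (V j * (J * V 0)) = (\<Sum>i\<in>{..4}. primary_action l i j *\<^sub>R (V i * (J * V 0)))"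
  proof (cases l)
    case None
    show ?thesis unfolding None sum_atMost_4
      using split_V[of "A * (V j * (J * V 0))"] by (simp add: gens_def primary_action_def ext_rels)
  next
    case (Some i)
    show ?thesis
    proof (cases "i = j")
      case True
      have "(\<Sum>i\<in>{..4}. primary_action l i j *\<^sub>R (V i * (J * V 0)))
          = (\<Sum>i\<in>{..4}. if i = j then V j * (J * V 0) else 0)"
        by (intro sum.cong) (auto simp: primary_action_def Some True)
      then show ?thesis using j Some True by (simp add: gens_def V_V_ext)
    qed (auto simp: Some gens_def V_V_ext primary_action_def intro!: sum.neutral[symmetric])
  qed
next
  fix i j assume "i \<in> {..4::nat}" "j \<in> {..4::nat}"
  then show "tp (V i * (J * V 0)) * (V j * (J * V 0)) = (if i = j then sz i *\<^sub>R V 0 else 0)"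
    by (simp add: mult.assoc V_V_ext ext_rels V0_J_V0)
next
  fix i assume "i \<in> {..4::nat}"
  then show "sz i \<noteq> 0" using sz_pos[of i] by simp
qed (auto simp: sym_idem_def V_V mult.assoc)

text \<open>Column \<open>j\<close> holds the coordinates of \<open>A\<close> times member
  \<open>j\<close> of \<open>local_basis\<close>. Member \<open>i\<close> lives on level
  \<open>i + 1\<close>, hence the shift for the level projections.\<close>

definition local_action :: "real \<Rightarrow> real \<Rightarrow> nat option \<Rightarrow> nat \<Rightarrow> nat \<Rightarrow> real" where
  "local_action \<eta> \<sigma> l i j = (case l of
     None \<Rightarrow> [[\<eta>, \<gamma> \<eta> \<sigma>, 0], [1, \<zeta> \<eta> \<sigma>, \<sigma>], [0, \<sigma> * \<gamma> \<eta> \<sigma>, \<eta>]] ! i ! j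
   | Some l \<Rightarrow> if i = j \<and> l = i + 1 then 1 else 0)"

definition local_basis :: "'a sqmat \<Rightarrow> nat \<Rightarrow> 'a sqmat" where
  "local_basis P i = [P, G * P, Pi * P] ! i"

lemma local_basis_level:
  assumes "local_module P \<eta> \<sigma>" "i < 3"
  shows "V (i + 1) * local_basis P i = local_basis P i"
proof -
  have "V 3 * (Pi * (V 1 * P)) = Pi * (V 1 * P)" by (simp add: rels)
  then have "V 3 * (Pi * P) = Pi * P" using local_moduleD(3)[OF assms(1)] by simp
  moreover have "V 2 * (G * P) = G * P" by (simp add: G_def rels)
  moreover have "i = 0 \<or> i = 1 \<or> i = 2" using assms(2) by auto
  ultimately show ?thesis using local_moduleD(3)[OF assms(1)] by (auto simp: local_basis_def)
qed

lemma local_thin_module: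
  assumes "local_module P \<eta> \<sigma>"
  shows "thin_module gens P {..<3} (local_basis P) ((!) [1, \<gamma> \<eta> \<sigma>, 1]) (local_action \<eta> \<sigma>)"
  unfolding thin_module_def
proof (intro conjI ballI allI)
  note P = local_moduleD[OF assms] and act = local_module_action[OF assms]
  have three: "i = 0 \<or> i = 1 \<or> i = 2" if "i \<in> {..<3}" for i :: nat using that by auto
  show "sym_idem P" using P by (simp add: sym_idem_def)
  fix i assume i: "i \<in> {..<3::nat}"
  show "[1, \<gamma> \<eta> \<sigma>, 1] ! i \<noteq> 0" "local_basis P i * P = local_basis P i"
    using three[OF i] P(1,8) by (auto simp: local_basis_def mult.assoc)
  fix j assume j: "j \<in> {..<3::nat}"
  show "tp (local_basis P i) * local_basis P j = (if i = j then ([1, \<gamma> \<eta> \<sigma>, 1] ! i) *\<^sub>R P else 0)"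
  proof (cases "i = j")
    case False
    have "tp (local_basis P i) * local_basis P j
        = tp (V (i + 1) * local_basis P i) * (V (j + 1) * local_basis P j)"
      using i j by (simp only: local_basis_level[OF assms] lessThan_iff)
    also have "\<dots> = 0" using False by (simp add: mult.assoc V_V_ext)
    finally show ?thesis using False by simp
  next
    case True
    have "Pi * (Pi * P) = P" by (simp add: ext_rels)
    then show ?thesis using three[OF i] True P act by (auto simp: local_basis_def mult.assoc)
  qed
  fix l
  show "gens l * local_basis P j = (\<Sum>i\<in>{..<3}. local_action \<eta> \<sigma> l i j *\<^sub>R local_basis P i)"
  proof (cases l)
    case None
    have AP: "A * P = \<eta> *\<^sub>R P + G * P"
      using arg_cong[OF A_V1, of "\<lambda>Z. Z * P"] P(3,5,6) by (simp add: mult.assoc distrib_right)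
    then have APiP: "A * (Pi * P) = \<sigma> *\<^sub>R (G * P) + \<eta> *\<^sub>R (Pi * P)"
      using act(2) by (simp add: distrib_left flip: ext_rels(2))
    \<comment> \<open>The level 3 part is the mirror image under \<open>Pi\<close> of the level 1
      part of \<open>A * (Pi * (G * P))\<close>.\<close>
    have "V 3 * (A * (V 2 * (G * P))) = Pi * (H * (Pi * (G * P)))"
      by (simp add: rels H_def)
    then have AGP: "A * (G * P) = \<gamma> \<eta> \<sigma> *\<^sub>R P + \<zeta> \<eta> \<sigma> *\<^sub>R (G * P) + (\<sigma> * \<gamma> \<eta> \<sigma>) *\<^sub>R (Pi * P)"
      using arg_cong[OF A_V2, of "\<lambda>Z. Z * (G * P)"] act mult_ext[OF block_rels(9), of P]
      by (simp add: mult.assoc distrib_right)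
    show ?thesis unfolding None sum_lessThan_3 using three[OF j]
      by (elim disjE) (simp_all add: gens_def local_action_def local_basis_def AP APiP AGP)
  next
    case (Some m)
    have "V m * local_basis P j = (if m = j + 1 then local_basis P j else 0)"
      using local_basis_level[OF assms, of j] j by (metis V_V_ext lessThan_iff)
    moreover have "(\<Sum>i\<in>{..<3}. local_action \<eta> \<sigma> l i j *\<^sub>R local_basis P i)
        = (\<Sum>i\<in>{..<3}. if i = j then (if m = j + 1 then local_basis P j else 0) else 0)"
      by (intro sum.cong) (auto simp: Some local_action_def)
    ultimately show ?thesis using j by (simp add: Some gens_def)
  qed
qed auto

text \<open>At \<open>p\<close> the Gram matrix for \<open>1 + Pi\<close> vanishes, so the image
  under \<open>G\<close> is skew and \<sigma> = -1; at \<open>- q\<close> the one for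
  \<open>1 - Pi\<close> vanishes, so the image is symmetric and \<sigma> = 1.\<close>

lemma local_modules:
  "local_module (eigen_part B Q (real p) (- real q)) (real p) (- 1)"
  "local_module (eigen_part B Q (- real q) (real p)) (- real q) 1"
proof -
  have pq: "real p \<noteq> - real q" "- real q \<noteq> real p" using p_ge q_ge by linarith+
  have quad: "B * (B * Q) = (real p + - real q) *\<^sub>R (B * Q) - (real p * - real q) *\<^sub>R Q"
    "B * (B * Q) = (- real q + real p) *\<^sub>R (B * Q) - (- real q * real p) *\<^sub>R Q"
    using local_quadratic by (simp_all add: mult.commute add.commute)
  note e1 = eigen_part[OF sym_idem_Q tp_blocks(1) Q_rels(2) quad(1) pq(1)]
  note e2 = eigen_part[OF sym_idem_Q tp_blocks(1) Q_rels(2) quad(2) pq(2)]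
  have Q: "V 1 * P = P \<and> J * P = 0" if "Q * P = P" for P
    using that Q_rels by (metis mult.assoc mult_zero_left)
  have ids: "k - c2 + (a1 - c2) * real p - (real p)\<^sup>2 = c2 * (1 + real p)"
    "k - c2 + (a1 - c2) * (- real q) - (- real q)\<^sup>2 = - c2 * (1 - real q)"
    by (simp_all add: k_def a1_def c2_def field_simps power2_eq_square)
  show "local_module (eigen_part B Q (real p) (- real q)) (real p) (- 1)"
    using e1 Q[OF e1(3)] ids(1) p_ge by (simp add: local_module_def)
  show "local_module (eigen_part B Q (- real q) (real p)) (- real q) 1"
    using e2 Q[OF e2(3)] ids(2) q_ge by (simp add: local_module_def)
qed

lemma tr_local_modules:
  "tr (eigen_part B Q \<alpha> \<beta>) = (- a1 - \<beta> * (k - 1)) / (\<alpha> - \<beta>)"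
  by (simp add: eigen_part_def tr_B_Q tr_Q)

definition J2 :: "'a sqmat" where "J2 = V 2 * (J * V 2)"

text \<open>Within the second subconstituent, this projects onto the orthogonal complement of the primary and local
  modules in the \<open>\<sigma>\<close>-eigenspace of \<^term>\<open>Pi\<close>; the complement is invariant under \<^term>\<open>A\<close>.\<close>

definition rest :: "'a sqmat \<Rightarrow> real \<Rightarrow> real \<Rightarrow> 'a sqmat" where
  "rest P \<eta> \<sigma> = (1 / 2) *\<^sub>R (V 2 + \<sigma> *\<^sub>R (V 2 * Pi)) - ((1 + \<sigma>) / (2 * sz 2)) *\<^sub>R J2
     - (1 / \<gamma> \<eta> \<sigma>) *\<^sub>R (G * (P * H))"

end

section \<open>The second subconstituent\<close>

context at4_base
begin

text \<open>Double counting of the edges between levels 1 and 2.\<close>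

lemma edge_count: "c2 * sz 2 = b1 * k"
proof -
  have 1: "J * (V 2 * (A * (V 1 * J))) = (c2 * sz 2) *\<^sub>R J"
    using arg_cong[OF V_A_V_J[of 2 1], of "\<lambda>Z. J * Z"] J_V_J[of 2] by (simp add: nbrs_values)
  have 2: "J * (V 2 * (A * (V 1 * J))) = (b1 * k) *\<^sub>R J"
    using arg_cong[OF J_V_A_V[of 2 1], of "\<lambda>Z. Z * J"] J_V_J[of 1]
    by (simp add: nbrs_values sz_values mult.assoc)
  have "entry ((c2 * sz 2) *\<^sub>R J) x x = entry ((b1 * k) *\<^sub>R J) x x" unfolding 1[symmetric] 2[symmetric] ..
  then show ?thesis by (simp add: entry_J)
qed

lemma rest_properties:
  assumes P: "local_module P \<eta> \<sigma>" and P': "local_module P' \<eta>' (- \<sigma>)" and sum: "P + P' = Q"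
  shows "sym_idem (rest P \<eta> \<sigma>)" "V 2 * rest P \<eta> \<sigma> = rest P \<eta> \<sigma>" "J * rest P \<eta> \<sigma> = 0"
    "Pi * rest P \<eta> \<sigma> = \<sigma> *\<^sub>R rest P \<eta> \<sigma>" "H * rest P \<eta> \<sigma> = 0" "C * rest P \<eta> \<sigma> = rest P \<eta> \<sigma> * C"
    "tr (rest P \<eta> \<sigma>) = (sz 2 - (1 + \<sigma>)) / 2 - tr P"
    "tr (A * rest P \<eta> \<sigma>) = - (1 + \<sigma>) / 2 * (k - 2 * c2) - \<zeta> \<eta> \<sigma> * tr P"
proof -
  \<comment> \<open>\<open>a\<close> projects onto the \<sigma>-half of level 2, \<open>b\<close>
    onto the constants in it (so \<open>b\<close> is zero for \<sigma> = -1), and \<open>c\<close>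
    onto the image of \<open>G * P\<close>. Both \<open>b\<close> and \<open>c\<close> lie below
    \<open>a\<close> and are orthogonal to each other, so \<open>a - b - c\<close> is again a
    projection.\<close>
  define s g where "s = (1 + \<sigma>) / 2" and "g = \<gamma> \<eta> \<sigma>"
  define a b c where "a = (1 / 2) *\<^sub>R (V 2 + \<sigma> *\<^sub>R (V 2 * Pi))" and "b = (s / sz 2) *\<^sub>R J2"
    and "c = (1 / g) *\<^sub>R (G * (P * H))"
  have F: "rest P \<eta> \<sigma> = a - b - c" by (simp add: rest_def a_def b_def c_def s_def g_def)
  note D = local_moduleD[OF P, folded g_def] and D' = local_moduleD[OF P']
  note act = local_module_action[OF P, folded g_def] and tact = local_module_action_tp[OF P, folded g_def]
  note tact' = local_module_action_tp[OF P']
  have sz2: "sz 2 \<noteq> 0" using sz_pos[of 2] by simp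
  have \<sigma>: "\<sigma> = 1 \<or> \<sigma> = - 1" using D(7) by (simp add: square_eq_1_iff)
  then have s: "\<sigma> * s = s" "s * s = s" by (auto simp: s_def)
  have actx: "H * (G * (P * Y)) = g *\<^sub>R (P * Y)" "Pi * (G * (P * Y)) = \<sigma> *\<^sub>R (G * (P * Y))"
    "C * (G * (P * Y)) = \<zeta> \<eta> \<sigma> *\<^sub>R (G * (P * Y))" for Y
    using act[THEN arg_cong, of "\<lambda>Z. Z * Y"] by (simp_all add: mult.assoc)
  have PP: "P * (P * Y) = P * Y" for Y using D(1) by (rule mult_ext)
  have JGP: "J * (G * (P * Y)) = 0" for Y
  proof -
    have "J * G = b1 *\<^sub>R (J * V 1)" by (simp add: rels G_def)
    from arg_cong[OF this, of "\<lambda>Z. Z * (P * Y)"] show ?thesis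
      using mult_ext[OF D(3), of Y] mult_ext[OF D(5), of Y] by (simp add: mult.assoc)
  qed
  have V2G: "V 2 * (G * Y) = G * Y" for Y by (simp add: rels G_def)
  have tps: "tp a = a" "tp b = b" "tp c = c"
    using D(2) by (simp_all add: a_def b_def c_def J2_def mult.assoc Pi_V)
  have aa: "a * a = a"
    using D(7) by (simp add: a_def rels algebra_simps) (rule sqmat_eqI, simp)
  have ab: "a * b = b"
  proof -
    have "a * J2 = s *\<^sub>R J2" by (simp add: a_def J2_def rels algebra_simps s_def) (rule sqmat_eqI, simp add: algebra_simps)
    then show ?thesis using s by (simp add: b_def)
  qed
  have ba: "b * a = b" using arg_cong[OF ab, of tp] tps by simp
  have bb: "b * b = b"
  proof -
    have "J2 * J2 = sz 2 *\<^sub>R J2" by (simp add: J2_def rels)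
    then show ?thesis using s sz2 by (simp add: b_def)
  qed
  have ac: "a * c = c"
    using D(7) by (simp add: a_def c_def distrib_right mult.assoc V2G actx)
  have ca: "c * a = c" using arg_cong[OF ac, of tp] tps by simp
  have cc: "c * c = c" using D(8) by (simp add: c_def mult.assoc actx PP)
  have bc: "b * c = 0" by (simp add: b_def c_def J2_def mult.assoc V2G JGP)
  have cb: "c * b = 0" using arg_cong[OF bc, of tp] tps by simp
  show "sym_idem (rest P \<eta> \<sigma>)" unfolding F sym_idem_def
    by (simp add: left_diff_distrib right_diff_distrib aa ab ba bb ac ca cc bc cb tps)
  show "V 2 * rest P \<eta> \<sigma> = rest P \<eta> \<sigma>" unfolding F
    by (simp add: right_diff_distrib a_def b_def c_def J2_def V2G rels distrib_left)
  show "J * rest P \<eta> \<sigma> = 0" unfolding F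
  proof -
    have "J * a = s *\<^sub>R (J * V 2)"
      by (simp add: a_def rels distrib_left s_def) (rule sqmat_eqI, simp add: algebra_simps)
    moreover have "J * b = s *\<^sub>R (J * V 2)" using sz2 by (simp add: b_def J2_def rels)
    moreover have "J * c = 0" by (simp add: c_def JGP)
    ultimately show "J * (a - b - c) = 0" by (simp add: right_diff_distrib)
  qed
  show "Pi * rest P \<eta> \<sigma> = \<sigma> *\<^sub>R rest P \<eta> \<sigma>" unfolding F
  proof -
    have "Pi * a = \<sigma> *\<^sub>R a" using D(7)
      by (simp add: a_def rels distrib_left scaleR_right_distrib)
    moreover have "Pi * b = \<sigma> *\<^sub>R b" using s by (simp add: b_def J2_def rels)
    moreover have "Pi * c = \<sigma> *\<^sub>R c" by (simp add: c_def actx)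
    ultimately show "Pi * (a - b - c) = \<sigma> *\<^sub>R (a - b - c)" by (simp add: right_diff_distrib scaleR_right_diff_distrib)
  qed
  show "H * rest P \<eta> \<sigma> = 0" unfolding F
  proof -
    \<comment> \<open>\<open>V 1\<close> splits into \<open>P\<close>, \<open>P'\<close> and a
      multiple of \<open>J1\<close>. Against \<open>a\<close> the part \<open>P'\<close> gives zero,
      as its image has the opposite sign under \<open>Pi\<close>; the part \<open>P\<close> is
      cancelled by \<open>c\<close>, and the constant part by \<open>b\<close> through
      \<open>edge_count\<close>.\<close>
    have PHa: "P * (H * a) = P * H" using D(7) tact(2)
      by (simp add: a_def distrib_left block_rels mult_ext[OF block_rels(11)])
    have P'Ha: "P' * (H * a) = 0" using D'(7) tact'(2)
      by (simp add: a_def distrib_left block_rels mult_ext[OF block_rels(11)])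
    have J1Ha: "J1 * (H * a) = (c2 * s) *\<^sub>R (V 1 * (J * V 2))"
      by (simp add: J1_def H_def a_def rels distrib_left s_def) (rule sqmat_eqI, simp add: algebra_simps)
    have "H * a = V 1 * (H * a)" using mult_ext[OF block_rels(10)] by simp
    also have "V 1 = Q + (1 / k) *\<^sub>R J1" by (simp add: Q_def)
    also have "(Q + (1 / k) *\<^sub>R J1) * (H * a) = P * H + (c2 * s / k) *\<^sub>R (V 1 * (J * V 2))"
      unfolding sum[symmetric] by (simp add: distrib_right PHa P'Ha J1Ha)
    finally have "H * a = P * H + (c2 * s / k) *\<^sub>R (V 1 * (J * V 2))" .
    moreover have "H * b = (b1 * s / sz 2) *\<^sub>R (V 1 * (J * V 2))" by (simp add: b_def J2_def H_def rels)
    moreover have "c2 * s / k = b1 * s / sz 2" using edge_count sz2 k_pos by (simp add: field_simps)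
    moreover have "H * c = P * H" using D(8) by (simp add: c_def actx)
    ultimately show "H * (a - b - c) = 0" by (simp add: right_diff_distrib)
  qed
  have Cb: "C * b = (k - 2 * c2) *\<^sub>R b" by (simp add: C_def b_def J2_def rels)
  have Cc: "C * c = \<zeta> \<eta> \<sigma> *\<^sub>R c" by (simp add: c_def actx)
  have "b * C = (k - 2 * c2) *\<^sub>R b" "c * C = \<zeta> \<eta> \<sigma> *\<^sub>R c"
    using arg_cong[OF Cb, of tp] arg_cong[OF Cc, of tp] tps by simp_all
  moreover have "C * a = a * C" by (simp add: C_def a_def rels distrib_left distrib_right)
  ultimately show "C * rest P \<eta> \<sigma> = rest P \<eta> \<sigma> * C"
    unfolding F by (simp add: left_diff_distrib right_diff_distrib Cb Cc)
  have tr_a: "tr a = sz 2 / 2" by (simp add: a_def tr_V tr_V_Pi)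
  have tr_b: "tr b = s"
  proof -
    have "tr J2 = sz 2" unfolding J2_def by (subst tr_commute) (simp add: rels tr_commute[of J] tr_V_J)
    then show ?thesis using sz2 by (simp add: b_def)
  qed
  have tr_c: "tr c = tr P"
  proof -
    have "tr (G * (P * H)) = tr (P * (H * G))" by (subst tr_commute) (simp add: mult.assoc)
    then show ?thesis using tact(1) D(8) by (simp add: c_def)
  qed
  show "tr (rest P \<eta> \<sigma>) = (sz 2 - (1 + \<sigma>)) / 2 - tr P"
    unfolding F by (simp add: tr_a tr_b tr_c s_def) (simp add: field_simps)
  have "tr (A * a) = 0"
    by (subst tr_commute) (simp add: a_def distrib_right mult.assoc tr_V_A tr_V_A_Pi Pi_A)
  moreover have "tr (A * b) = (k - 2 * c2) * s"
  proof -
    have "tr (A * J2) = tr (V 2 * (A * (V 2 * J)))"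
      unfolding J2_def using tr_commute[of "A * (V 2 * J)" "V 2"] by (simp add: mult.assoc)
    then show ?thesis using sz2 by (simp add: b_def rels tr_V_J)
  qed
  moreover have "tr (A * c) = \<zeta> \<eta> \<sigma> * tr P"
  proof -
    have "tr (A * c) = tr (A * (V 2 * (c * V 2)))"
      using V2G by (simp add: c_def mult.assoc block_rels)
    also have "\<dots> = tr (C * c)"
      using tr_commute[of "A * (V 2 * c)" "V 2"] by (simp add: C_def mult.assoc)
    finally show ?thesis by (simp add: Cc tr_c)
  qed
  ultimately show "tr (A * rest P \<eta> \<sigma>) = - (1 + \<sigma>) / 2 * (k - 2 * c2) - \<zeta> \<eta> \<sigma> * tr P"
    unfolding F right_diff_distrib by (simp add: s_def field_simps)
qed

text \<open>On the range of \<open>rest P \<eta> \<sigma>\<close>, \<open>J\<close> is zero and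
  \<open>Pi\<close> is the scalar \<sigma>, so \<open>A_A\<close> becomes a quadratic equation with
  roots \<alpha> and \<beta>. \<open>A\<close> preserves the range because \<open>H\<close> vanishes
  there and level 3 mirrors level 1. Each eigenvector spans a module, so \<open>W\<close> is both
  the multiplicity projection and its single embedding.\<close>

lemma rest_eigen_part:
  assumes P: "local_module P \<eta> \<sigma>" and P': "local_module P' \<eta>' (- \<sigma>)" and sum: "P + P' = Q"
    and \<alpha>\<beta>: "\<alpha> + \<beta> = a1 - c2 * (1 + \<sigma>)" "\<alpha> * \<beta> = - (k - c2 * (1 + \<sigma>))" "\<alpha> \<noteq> \<beta>"
  defines "W \<equiv> eigen_part A (rest P \<eta> \<sigma>) \<alpha> \<beta>"
  shows "thin_module gens W {0::nat} (\<lambda>_. W) (\<lambda>_. 1)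
      (\<lambda>l _ _. case l of None \<Rightarrow> \<alpha> | Some i \<Rightarrow> if i = 2 then 1 else 0)"
    and "eigen_part A (rest P \<eta> \<sigma>) \<alpha> \<beta> + eigen_part A (rest P \<eta> \<sigma>) \<beta> \<alpha> = rest P \<eta> \<sigma>"
    and "tr W = (- (1 + \<sigma>) / 2 * (k - 2 * c2) - \<zeta> \<eta> \<sigma> * tr P - \<beta> * ((sz 2 - (1 + \<sigma>)) / 2 - tr P)) / (\<alpha> - \<beta>)"
proof -
  define F where "F = rest P \<eta> \<sigma>"
  note R = rest_properties[OF P P' sum, folded F_def]
  have AF: "A * F = C * F"
  proof -
    have "V 3 * (A * (V 2 * F)) = Pi * (H * (Pi * F))" by (simp add: rels H_def)
    then have "V 3 * (A * (V 2 * F)) = 0" using R(4,5) by simp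
    then show ?thesis using arg_cong[OF A_V2, of "\<lambda>Z. Z * F"] R(2,5)
      by (simp add: mult.assoc distrib_right)
  qed
  have FA: "F * A = F * C" using arg_cong[OF AF, of tp] R(1) by (simp add: sym_idem_def)
  have comm: "A * F = F * A" unfolding AF FA by (rule R(6))
  have quad: "A * (A * F) = (\<alpha> + \<beta>) *\<^sub>R (A * F) - (\<alpha> * \<beta>) *\<^sub>R F"
    unfolding \<alpha>\<beta>(1,2) A_A_mult R(3,4) by simp (rule sqmat_eqI, simp add: algebra_simps)
  note e = eigen_part[OF R(1) tp_AJPi(1) comm quad \<alpha>\<beta>(3), folded W_def, unfolded F_def, folded W_def]
  have "V i * W = (if i = 2 then W else 0)" for i
  proof -
    have "V 2 * W = W" using R(2) e(3) unfolding F_def by (metis mult.assoc)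
    then show ?thesis using V_V_ext[of i 2 W] by auto
  qed
  then show "thin_module gens W {0::nat} (\<lambda>_. W) (\<lambda>_. 1)
      (\<lambda>l _ _. case l of None \<Rightarrow> \<alpha> | Some i \<Rightarrow> if i = 2 then 1 else 0)"
    using e(1,2) by (simp add: thin_module_def gens_def sym_idem_def split: option.split)
  show "eigen_part A (rest P \<eta> \<sigma>) \<alpha> \<beta> + eigen_part A (rest P \<eta> \<sigma>) \<beta> \<alpha> = rest P \<eta> \<sigma>"
    using e(4) unfolding W_def .
  show "tr W = (- (1 + \<sigma>) / 2 * (k - 2 * c2) - \<zeta> \<eta> \<sigma> * tr P - \<beta> * ((sz 2 - (1 + \<sigma>)) / 2 - tr P)) / (\<alpha> - \<beta>)"
    using e(5) R(7,8) unfolding F_def by simp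
qed

section \<open>Decomposition of the standard module\<close>

definition Pp :: "'a sqmat" where "Pp = eigen_part B Q (real p) (- real q)"
definition Pq :: "'a sqmat" where "Pq = eigen_part B Q (- real q) (real p)"
definition Fp :: "'a sqmat" where "Fp = rest Pp (real p) (- 1)"
definition Fq :: "'a sqmat" where "Fq = rest Pq (- real q) 1"

lemma Pp_Pq: "local_module Pp (real p) (- 1)" "local_module Pq (- real q) 1" "Pp + Pq = Q"
proof -
  show "local_module Pp (real p) (- 1)" "local_module Pq (- real q) 1"
    using local_modules by (simp_all add: Pp_def Pq_def)
  have "real p \<noteq> - real q" using p_ge q_ge by linarith
  then show "Pp + Pq = Q" unfolding Pp_def Pq_def
    using eigen_part(4)[OF sym_idem_Q tp_blocks(1) Q_rels(2) local_quadratic] by simp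
qed

text \<open>The roots of the quadratic equation for \<open>A\<close> on the skew half (\<sigma> =
  -1), then on the symmetric half (\<sigma> = 1).\<close>

lemma eigenvalues:
  "\<theta> + - real q = a1 - c2 * (1 + (- 1))" "\<theta> * - real q = - (k - c2 * (1 + (- 1)))" "\<theta> \<noteq> - real q"
  "real p + - (real q)\<^sup>2 = a1 - c2 * (1 + 1)" "real p * - (real q)\<^sup>2 = - (k - c2 * (1 + 1))" "real p \<noteq> - (real q)\<^sup>2"
proof -
  have "0 < real q" "0 < real p" using p_ge q_ge by linarith+
  then have "0 < real q + \<theta>" "0 < real p + (real q)\<^sup>2" by (auto simp: \<theta>_def intro!: add_pos_pos mult_pos_pos)
  then show "\<theta> \<noteq> - real q" "real p \<noteq> - (real q)\<^sup>2" by linarith+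
qed (simp_all add: \<theta>_def k_def a1_def c2_def algebra_simps power2_eq_square)

lemma Fp_modules:
  assumes "\<alpha> = \<theta> \<and> \<beta> = - real q \<or> \<alpha> = - real q \<and> \<beta> = \<theta>"
  shows "thin_module gens (eigen_part A Fp \<alpha> \<beta>) {0::nat} (\<lambda>_. eigen_part A Fp \<alpha> \<beta>) (\<lambda>_. 1)
      (\<lambda>l _ _. case l of None \<Rightarrow> \<alpha> | Some i \<Rightarrow> if i = 2 then 1 else 0)"
    and "eigen_part A Fp \<alpha> \<beta> + eigen_part A Fp \<beta> \<alpha> = Fp"
    and "tr (eigen_part A Fp \<alpha> \<beta>) = (- \<zeta> (real p) (- 1) * tr Pp - \<beta> * (sz 2 / 2 - tr Pp)) / (\<alpha> - \<beta>)"
proof -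
  have "\<alpha> + \<beta> = a1 - c2 * (1 + (- 1))" "\<alpha> * \<beta> = - (k - c2 * (1 + (- 1)))" "\<alpha> \<noteq> \<beta>"
    using assms eigenvalues(1-3) by (auto simp: algebra_simps)
  note r = rest_eigen_part[OF Pp_Pq(1) _ Pp_Pq(3) this, folded Fp_def]
  show "thin_module gens (eigen_part A Fp \<alpha> \<beta>) {0::nat} (\<lambda>_. eigen_part A Fp \<alpha> \<beta>) (\<lambda>_. 1)
      (\<lambda>l _ _. case l of None \<Rightarrow> \<alpha> | Some i \<Rightarrow> if i = 2 then 1 else 0)"
    "eigen_part A Fp \<alpha> \<beta> + eigen_part A Fp \<beta> \<alpha> = Fp"
    "tr (eigen_part A Fp \<alpha> \<beta>) = (- \<zeta> (real p) (- 1) * tr Pp - \<beta> * (sz 2 / 2 - tr Pp)) / (\<alpha> - \<beta>)"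
    using r Pp_Pq(2) by simp_all
qed

lemma Fq_modules:
  assumes "\<alpha> = real p \<and> \<beta> = - (real q)\<^sup>2 \<or> \<alpha> = - (real q)\<^sup>2 \<and> \<beta> = real p"
  shows "thin_module gens (eigen_part A Fq \<alpha> \<beta>) {0::nat} (\<lambda>_. eigen_part A Fq \<alpha> \<beta>) (\<lambda>_. 1)
      (\<lambda>l _ _. case l of None \<Rightarrow> \<alpha> | Some i \<Rightarrow> if i = 2 then 1 else 0)"
    and "eigen_part A Fq \<alpha> \<beta> + eigen_part A Fq \<beta> \<alpha> = Fq"
    and "tr (eigen_part A Fq \<alpha> \<beta>) = (- (k - 2 * c2) - \<zeta> (- real q) 1 * tr Pq - \<beta> * ((sz 2 - 2) / 2 - tr Pq)) / (\<alpha> - \<beta>)"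
proof -
  have "\<alpha> + \<beta> = a1 - c2 * (1 + 1)" "\<alpha> * \<beta> = - (k - c2 * (1 + 1))" "\<alpha> \<noteq> \<beta>"
    using assms eigenvalues(4-6) by (auto simp: algebra_simps)
  note r = rest_eigen_part[OF Pp_Pq(2) _ _ this, folded Fq_def]
  show "thin_module gens (eigen_part A Fq \<alpha> \<beta>) {0::nat} (\<lambda>_. eigen_part A Fq \<alpha> \<beta>) (\<lambda>_. 1)
      (\<lambda>l _ _. case l of None \<Rightarrow> \<alpha> | Some i \<Rightarrow> if i = 2 then 1 else 0)"
    "eigen_part A Fq \<alpha> \<beta> + eigen_part A Fq \<beta> \<alpha> = Fq"
    "tr (eigen_part A Fq \<alpha> \<beta>) = (- (k - 2 * c2) - \<zeta> (- real q) 1 * tr Pq - \<beta> * ((sz 2 - 2) / 2 - tr Pq)) / (\<alpha> - \<beta>)"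
    using r[OF Pp_Pq(1)] Pp_Pq(3) by (simp_all add: add.commute)
qed

definition projections :: "'a sqmat list" where
  "projections = [module_proj {..4} (\<lambda>i. V i * (J * V 0)) sz,
     module_proj {..<3} (local_basis Pp) ((!) [1, \<gamma> (real p) (- 1), 1]),
     module_proj {..<3} (local_basis Pq) ((!) [1, \<gamma> (- real q) 1, 1]),
     module_proj {0::nat} (\<lambda>_. eigen_part A Fp \<theta> (- real q)) (\<lambda>_. 1),
     module_proj {0::nat} (\<lambda>_. eigen_part A Fp (- real q) \<theta>) (\<lambda>_. 1),
     module_proj {0::nat} (\<lambda>_. eigen_part A Fq (real p) (- (real q)\<^sup>2)) (\<lambda>_. 1),
     module_proj {0::nat} (\<lambda>_. eigen_part A Fq (- (real q)\<^sup>2) (real p)) (\<lambda>_. 1)]"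

lemma module_proj_local:
  assumes "local_module P \<eta> \<sigma>"
  shows "module_proj {..<3} (local_basis P) ((!) [1, \<gamma> \<eta> \<sigma>, 1])
    = P + (1 / \<gamma> \<eta> \<sigma>) *\<^sub>R (G * (P * H)) + Pi * (P * Pi)"
proof -
  note P = local_moduleD[OF assms]
  have "P * (P * Y) = P * Y" for Y using P(1) by (rule mult_ext)
  then show ?thesis using P(1,2)
    by (simp add: module_proj_def sum_lessThan_3 local_basis_def mult.assoc)
qed

lemma module_proj_single:
  assumes "thin_module X W {0::nat} (\<lambda>_. W) (\<lambda>_. 1) m"
  shows "module_proj {0::nat} (\<lambda>_. W) (\<lambda>_. 1) = W"
  using assms by (simp add: module_proj_def thin_module_def sym_idem_def)

lemma module_proj_primary:
  "module_proj {..4} (\<lambda>i. V i * (J * V 0)) sz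
    = V 0 + (1 / k) *\<^sub>R J1 + (1 / sz 2) *\<^sub>R J2 + (1 / k) *\<^sub>R (Pi * (J1 * Pi)) + V 4"
proof -
  have "V 4 * (J * V 4) = Pi * (V 0 * (J * (V 0 * Pi)))" by (simp add: rels)
  also have "\<dots> = V 4" by (simp add: ext_rels Pi_V) (simp add: rels)
  finally have 4: "V 4 * (J * V 4) = V 4" .
  have "Pi * (J1 * Pi) = V 3 * (J * V 3)" by (simp add: J1_def rels)
  then show ?thesis
    unfolding module_proj_def sum_atMost_4
    by (simp add: mult.assoc V_V V_V_ext ext_rels sz_values V0_J_V0 4 J1_def J2_def)
qed

text \<open>Levels 0 and 4 belong to the primary module; levels 1 and 3 split into constants and the
  copies of \<open>Pp\<close> and \<open>Pq\<close>; in level 2 the terms subtracted in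
  \<open>rest\<close> are the contributions of the primary and local modules.\<close>

lemma sum_projections: "sum_list projections = 1"
proof -
  note Fs = Fp_modules[of \<theta> "- real q"] Fp_modules[of "- real q" \<theta>]
    Fq_modules[of "real p" "- (real q)\<^sup>2"] Fq_modules[of "- (real q)\<^sup>2" "real p"]
  define gp gq where "gp = (1 / \<gamma> (real p) (- 1)) *\<^sub>R (G * (Pp * H))"
    and "gq = (1 / \<gamma> (- real q) 1) *\<^sub>R (G * (Pq * H))"
  have "sum_list projections = V 0 + (1 / k) *\<^sub>R J1 + (1 / sz 2) *\<^sub>R J2 + (1 / k) *\<^sub>R (Pi * (J1 * Pi)) + V 4
      + (Pp + gp + Pi * (Pp * Pi)) + (Pq + gq + Pi * (Pq * Pi)) + Fp + Fq"
    unfolding projections_def gp_def gq_def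
    using Fs module_proj_single[OF Fs(1)] module_proj_single[OF Fs(4)]
      module_proj_single[OF Fs(7)] module_proj_single[OF Fs(10)]
    by (simp add: module_proj_primary module_proj_local Pp_Pq add.assoc)
  moreover have "Pi * (Pp * Pi) + Pi * (Pq * Pi) = V 3 - (1 / k) *\<^sub>R (Pi * (J1 * Pi))"
  proof -
    have "Pi * (Pp * Pi) + Pi * (Pq * Pi) = Pi * (Q * Pi)"
      by (simp add: Pp_Pq(3)[symmetric] distrib_left distrib_right)
    also have "\<dots> = Pi * (V 1 * Pi) - (1 / k) *\<^sub>R (Pi * (J1 * Pi))"
      by (simp add: Q_def left_diff_distrib right_diff_distrib)
    also have "Pi * (V 1 * Pi) = V 3" by (simp add: rels)
    finally show ?thesis .
  qed
  then have "Pi * (Pq * Pi) = V 3 - (1 / k) *\<^sub>R (Pi * (J1 * Pi)) - Pi * (Pp * Pi)"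
    by (simp add: algebra_simps)
  moreover have "Pq = V 1 - (1 / k) *\<^sub>R J1 - Pp" using Pp_Pq(3) by (simp add: Q_def algebra_simps)
  \<comment> \<open>Adding the skew and the symmetric half cancels the terms with \<open>Pi\<close>;
    the constants enter only through the symmetric half.\<close>
  moreover have "Fp + Fq = V 2 - (1 / sz 2) *\<^sub>R J2 - gp - gq"
    unfolding Fp_def Fq_def rest_def gp_def gq_def by (rule sqmat_eqI) (simp add: algebra_simps)
  then have "Fq = V 2 - (1 / sz 2) *\<^sub>R J2 - gp - gq - Fp" by (simp add: algebra_simps)
  ultimately have "sum_list projections = V 0 + V 1 + V 2 + V 3 + V 4" by simp
  then show ?thesis by (simp add: V_sum)
qed

end

section \<open>Comparison of two base vertices\<close>

context at4
begin

text \<open>Weights, structure constants and traces are expressions in \<open>p\<close>,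
  \<open>q\<close> and the number of vertices, so they agree for \<open>x\<close> and
  \<open>y\<close> and the families can be matched one by one. In particular
  \<open>X.\<gamma>\<close> serves both base vertices.\<close>

lemma intertwined_base_points: "intertwined (at4_base.gens E x) (at4_base.gens E y) 1 1"
proof -
  interpret X: at4_base E p q x by unfold_locales
  interpret Y: at4_base E p q y by unfold_locales
  note intertwine = thin_module_intertwined[OF _ _ _ X.tp_gens]
  have trP: "tr X.Pp = tr Y.Pp" "tr X.Pq = tr Y.Pq"
    by (simp_all add: X.Pp_def Y.Pp_def X.Pq_def Y.Pq_def X.tr_local_modules Y.tr_local_modules)
  have "list_all2 (intertwined X.gens Y.gens) X.projections Y.projections"
    unfolding X.projections_def Y.projections_def list.rel_inject
  proof (intro conjI)
    show "intertwined X.gens Y.gens (module_proj {..4} (\<lambda>i. X.V i * (J * X.V 0)) sz)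
        (module_proj {..4} (\<lambda>i. Y.V i * (J * Y.V 0)) sz)"
      by (rule intertwine[OF X.primary_module Y.primary_module]) (simp add: X.tr_V Y.tr_V)
    show "intertwined X.gens Y.gens (module_proj {..<3} (X.local_basis X.Pp) ((!) [1, X.\<gamma> (real p) (- 1), 1]))
        (module_proj {..<3} (Y.local_basis Y.Pp) ((!) [1, X.\<gamma> (real p) (- 1), 1]))"
      by (rule intertwine[OF X.local_thin_module[OF X.Pp_Pq(1)] Y.local_thin_module[OF Y.Pp_Pq(1)] trP(1)])
    show "intertwined X.gens Y.gens (module_proj {..<3} (X.local_basis X.Pq) ((!) [1, X.\<gamma> (- real q) 1, 1]))
        (module_proj {..<3} (Y.local_basis Y.Pq) ((!) [1, X.\<gamma> (- real q) 1, 1]))"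
      by (rule intertwine[OF X.local_thin_module[OF X.Pp_Pq(2)] Y.local_thin_module[OF Y.Pp_Pq(2)] trP(2)])
    show "list_all2 (intertwined X.gens Y.gens) [] []" by simp
  qed (rule intertwine, (rule X.Fp_modules X.Fq_modules Y.Fp_modules Y.Fq_modules; simp)+,
      simp add: X.Fp_modules Y.Fp_modules X.Fq_modules Y.Fq_modules trP)+
  then show ?thesis using X.sum_projections Y.sum_projections by (rule intertwined_partition)
qed

end

theorem theorem8p7:
  fixes E :: "'a::finite \<Rightarrow> 'a \<Rightarrow> bool" and p q :: nat
  assumes "AT4 E p q"
  shows "pseudo_vertex_transitive E 4"
proof (rule pseudo_vertex_transitiveI)
  interpret at4 E p q by unfold_locales (rule assms)
  fix x y
  interpret X: at4_base E p q x by unfold_locales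
  interpret Y: at4_base E p q y by unfold_locales
  obtain \<rho> where \<rho>: "\<And>l. Y.gens l * \<rho> = \<rho> * X.gens l" "tp \<rho> * \<rho> = 1 \<and> \<rho> * tp \<rho> = 1"
    using intertwined_base_points[of x y] unfolding intertwined_def by (elim conjE exE) (rule that, simp_all)
  have "adj E * \<rho> = \<rho> * adj E" using \<rho>(1)[of None] by (simp add: X.gens_def Y.gens_def A_def)
  moreover have "dual E y i * \<rho> = \<rho> * dual E x i" for i
    using \<rho>(1)[of "Some i"] by (simp add: X.gens_def Y.gens_def X.V_def Y.V_def)
  ultimately show "\<exists>\<rho>. tp \<rho> * \<rho> = 1 \<and> \<rho> * tp \<rho> = 1 \<and> adj E * \<rho> = \<rho> * adj E \<and>
    (\<forall>i\<le>4. dual E y i * \<rho> = \<rho> * dual E x i)"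
    using \<rho>(2) by (intro exI[of _ \<rho>]) simp
qed

end
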